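(* Let $\tau$ be a left proper, reasonable and quasi-invertible substitution with fixed point $u$. Then there exists a semi-proper, stationary Bratteli diagram $\mathcal B$ such that $(X_{\mathcal B},V_{\mathcal B})$ is topologically conjugate to $(X_\tau,\sigma)$.
   Context: **Substitutions.** $\mathcal A$ is a finite alphabet, $\mathcal A^+$ the set of nonempty finite words, $\mathbb N=\{0,1,\dots\}$, $|w|$ the length of a word $w$. $\mathcal A^{\mathbb N}$ carries the product topology and $\sigma$ is the left shift, $(\sigma x)_m=x_{m+1}$. A substitution is a map $\tau:\mathcal A\to\mathcal A^+$, extended by concatenation to words and to one-sided sequences. $\tau$ is left proper if there is a letter $l$ which is the first letter of $\tau(a)$ for every $a\in\mathcal A$. $\mathcal L_\tau$ is the set of all subwords of the words $\tau^n(a)$, $n\ge 1$, $a\in\mathcal A$; $X_\tau\subset\mathcal A^{\mathbb N}$ is the set of sequences all of whose finite subwords lie in $\mathcal L_\tau$. A fixed point of $\tau$ is $u\in\mathcal A^{\mathbb N}$ with $\tau(u)=u$; it is generating if the set of words occurring in $u$ equals $\mathcal L_\tau$ and $|\tau^n(u_0)|\to\infty$. $\tau$ is minimal if it has a generating fixed point $u$ and $(X_\tau,\sigma)$ is minimal (every forward orbit is dense in $X_\tau$). $\tau$ is injective if $\tau(a)\ne\tau(b)$ for $a\neq b$ in $\mathcal A$. With $E=\{0\}\cup\{|\tau(u_0\cdots u_{p-1})|:p>0\}$, $\tau$ is (unilaterally) recognizable if there is $L$ such that $u_i\cdots u_{i+L-1}=u_j\cdots u_{j+L-1}$ and $i\in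 E$ imply $j\in E$. $\tau$ is reasonable if it is minimal and recognizable and all powers $\tau^n$, $n\ge1$, are injective as substitutions. **Quasi-invertibility.** A point of $X_\tau$ is a branch point if it has more than one $\sigma$-preimage in $X_\tau$; $\tau$ (or $(X_\tau,\sigma)$) is quasi-invertible if $X_\tau$ has exactly one branch point. **Bratteli diagrams.** A Bratteli diagram $\mathcal B=(\mathcal V,\mathcal E)$ has vertex set $\bigsqcup_{n\ge0}\mathcal V_n$ and edge set $\bigsqcup_{n\ge1}\mathcal E_n$, all $\mathcal V_n,\mathcal E_n$ finite, $\mathcal V_0=\{v_0\}$; each $x\in\mathcal E_n$ has source $s(x)\in\mathcal V_{n-1}$ and range $r(x)\in\mathcal V_n$; $s^{-1}(v)\ne\emptyset$ for all $v$ and $r^{-1}(v)\neq\emptyset$ for $v\ne v_0$. $X_{\mathcal B}\subset\prod_{n\geq 1}\mathcal E_n$ is the space of infinite paths $(x_n)_{n\ge1}$ with $s(x_{n+1})=r(x_n)$, with the induced product topology. $\mathcal B$ is simple if it has a telescoping (passing to a subsequence of levels $0=n_0<n_1<\cdots$, with edges being the paths between the chosen levels) in which every vertex of level $n\geq1$ is joined by at least one edge to every vertex of level $n+1$. $\mathcal B$ is ordered if each set $\mathcal E_n(a)=\{x\in\mathcal E_n:r(x)=a\}$ is linearly ordered. A path is maximal (minimal) if all its edges are maximal (minimal). If $x=(x_n)$ is not maximal, let $k$ be least with $x_k$ not maximal and $y_k$ the successor of $x_k$ in $\mathcal E_k(r(x_k))$; then $V_{\mathcal B}(x)$ is the path that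 agrees with $x$ at levels $>k$, has $k$-th edge $y_k$, and below level $k$ is the unique minimal path from $v_0$ to $s(y_k)$. $\mathcal B$ is semi-proper if it is a simple ordered diagram with a unique minimal path $x_{\min}$; then $V_{\mathcal B}$ is extended to a continuous surjection of $X_{\mathcal B}$ by sending every maximal path to $x_{\min}$. $\mathcal B$ is stationary if the vertex sets $\mathcal V_n$ ($n\ge1$) can be identified with one another so that all $\mathcal E_n$, $n\ge2$, are the same as ordered edge sets (no condition on $\mathcal E_1$). *)

theory Defs
  imports "HOL-Analysis.Analysis" "HOL-Library.Sublist"
begin

section \<open>Substitutions and their one-sided subshifts\<close>

definition substitution :: "('a \<Rightarrow> 'a list) \<Rightarrow> bool" where
  "substitution \<tau> \<longleftrightarrow> (\<forall>a. \<tau> a \<noteq> [])"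

definition subst_word :: "('a \<Rightarrow> 'a list) \<Rightarrow> 'a list \<Rightarrow> 'a list" where
  "subst_word \<tau> w = concat (map \<tau> w)"

definition subst_power :: "('a \<Rightarrow> 'a list) \<Rightarrow> nat \<Rightarrow> 'a \<Rightarrow> 'a list" where
  "subst_power \<tau> n a = (subst_word \<tau> ^^ n) [a]"

definition prefix_word :: "(nat \<Rightarrow> 'a) \<Rightarrow> nat \<Rightarrow> 'a list" where
  "prefix_word x n = map x [0..<n]"

text \<open>
  The infinite concatenation of the words \<open>\<tau> (x 0), \<tau> (x 1), \<dots>\<close>. Since all these words are
  nonempty, the first \<open>m + 1\<close> of them already determine the letter at position \<open>m\<close>.
\<close>
definition subst_seq :: "('a \<Rightarrow> 'a list) \<Rightarrow> (nat \<Rightarrow> 'a) \<Rightarrow> nat \<Rightarrow> 'a" where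
  "subst_seq \<tau> x m = subst_word \<tau> (prefix_word x (Suc m)) ! m"

definition left_proper :: "('a \<Rightarrow> 'a list) \<Rightarrow> bool" where
  "left_proper \<tau> \<longleftrightarrow> (\<exists>l. \<forall>a. hd (\<tau> a) = l)"

definition language :: "('a \<Rightarrow> 'a list) \<Rightarrow> 'a list set" where
  "language \<tau> = {w. \<exists>n\<ge>1. \<exists>a. sublist w (subst_power \<tau> n a)}"

definition factors :: "(nat \<Rightarrow> 'a) \<Rightarrow> 'a list set" where
  "factors x = {map x [i..<i + k] | i k. True}"

definition subst_space :: "('a \<Rightarrow> 'a list) \<Rightarrow> (nat \<Rightarrow> 'a) set" where
  "subst_space \<tau> = {x. factors x \<subseteq> language \<tau>}"

definition seq_shift :: "(nat \<Rightarrow> 'a) \<Rightarrow> nat \<Rightarrow> 'a" where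
  "seq_shift x = (\<lambda>m. x (Suc m))"

definition seq_topology :: "(nat \<Rightarrow> 'a) topology" where
  "seq_topology = product_topology (\<lambda>_. discrete_topology UNIV) UNIV"

definition subst_topology :: "('a \<Rightarrow> 'a list) \<Rightarrow> (nat \<Rightarrow> 'a) topology" where
  "subst_topology \<tau> = subtopology seq_topology (subst_space \<tau>)"

definition fixed_point :: "('a \<Rightarrow> 'a list) \<Rightarrow> (nat \<Rightarrow> 'a) \<Rightarrow> bool" where
  "fixed_point \<tau> u \<longleftrightarrow> subst_seq \<tau> u = u"

definition generating_fixed_point :: "('a \<Rightarrow> 'a list) \<Rightarrow> (nat \<Rightarrow> 'a) \<Rightarrow> bool" where
  "generating_fixed_point \<tau> u \<longleftrightarrow>
     fixed_point \<tau> u \<and> factors u = language \<tau> \<and>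
     filterlim (\<lambda>n. length (subst_power \<tau> n (u 0))) at_top sequentially"

definition minimal_system :: "'x topology \<Rightarrow> ('x \<Rightarrow> 'x) \<Rightarrow> bool" where
  "minimal_system X f \<longleftrightarrow>
     (\<forall>x\<in>topspace X. X closure_of {(f ^^ n) x | n. True} = topspace X)"

definition minimal_subst :: "('a \<Rightarrow> 'a list) \<Rightarrow> bool" where
  "minimal_subst \<tau> \<longleftrightarrow>
     (\<exists>u. generating_fixed_point \<tau> u) \<and> minimal_system (subst_topology \<tau>) seq_shift"

definition injective_subst :: "('a \<Rightarrow> 'a list) \<Rightarrow> bool" where
  "injective_subst \<tau> \<longleftrightarrow> inj \<tau>"

definition cut_points :: "('a \<Rightarrow> 'a list) \<Rightarrow> (nat \<Rightarrow> 'a) \<Rightarrow> nat set" where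
  "cut_points \<tau> u = {0} \<union> {length (subst_word \<tau> (prefix_word u p)) | p. p > 0}"

definition recognizable :: "('a \<Rightarrow> 'a list) \<Rightarrow> (nat \<Rightarrow> 'a) \<Rightarrow> bool" where
  "recognizable \<tau> u \<longleftrightarrow>
     (\<exists>L. \<forall>i j. map u [i..<i + L] = map u [j..<j + L] \<longrightarrow>
        i \<in> cut_points \<tau> u \<longrightarrow> j \<in> cut_points \<tau> u)"

definition reasonable :: "('a \<Rightarrow> 'a list) \<Rightarrow> (nat \<Rightarrow> 'a) \<Rightarrow> bool" where
  "reasonable \<tau> u \<longleftrightarrow>
     minimal_subst \<tau> \<and> recognizable \<tau> u \<and> (\<forall>n\<ge>1. injective_subst (subst_power \<tau> n))"

definition branch_point :: "('a \<Rightarrow> 'a list) \<Rightarrow> (nat \<Rightarrow> 'a) \<Rightarrow> bool" where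
  "branch_point \<tau> x \<longleftrightarrow> x \<in> subst_space \<tau> \<and>
     (\<exists>y\<in>subst_space \<tau>. \<exists>z\<in>subst_space \<tau>. y \<noteq> z \<and> seq_shift y = x \<and> seq_shift z = x)"

definition quasi_invertible :: "('a \<Rightarrow> 'a list) \<Rightarrow> bool" where
  "quasi_invertible \<tau> \<longleftrightarrow> (\<exists>!x. branch_point \<tau> x)"


section \<open>Bratteli diagrams\<close>

text \<open>
  The levels are indexed families, so a vertex is really a pair of a level \<open>n\<close> and an element of
  \<open>vertices B n\<close>, and similarly for edges; this makes the unions over all levels disjoint.
  Edges live at levels \<open>n \<ge> 1\<close>; the components at level \<open>0\<close> of \<open>edges\<close>, \<open>src\<close>, \<open>rng\<close> and \<open>eord\<close>
  carry no meaning. The relation \<open>eord B n a\<close> is the (reflexive) order on the edges of level \<open>n\<close>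
  with range \<open>a\<close>.
\<close>
record ('v, 'e) bratteli =
  vertices :: "nat \<Rightarrow> 'v set"
  edges :: "nat \<Rightarrow> 'e set"
  src :: "nat \<Rightarrow> 'e \<Rightarrow> 'v"
  rng :: "nat \<Rightarrow> 'e \<Rightarrow> 'v"

record ('v, 'e) ordered_bratteli = "('v, 'e) bratteli" +
  eord :: "nat \<Rightarrow> 'v \<Rightarrow> 'e rel"

definition bratteli_diagram :: "('v, 'e, 'm) bratteli_scheme \<Rightarrow> bool" where
  "bratteli_diagram B \<longleftrightarrow>
     (\<forall>n. finite (vertices B n)) \<and>
     (\<forall>n\<ge>1. finite (edges B n)) \<and>
     (\<exists>v\<^sub>0. vertices B 0 = {v\<^sub>0}) \<and>
     (\<forall>n. \<forall>e\<in>edges B (Suc n).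
        src B (Suc n) e \<in> vertices B n \<and> rng B (Suc n) e \<in> vertices B (Suc n)) \<and>
     (\<forall>n. \<forall>v\<in>vertices B n. \<exists>e\<in>edges B (Suc n). src B (Suc n) e = v) \<and>
     (\<forall>n\<ge>1. \<forall>v\<in>vertices B n. \<exists>e\<in>edges B n. rng B n e = v)"

definition path_space :: "('v, 'e, 'm) bratteli_scheme \<Rightarrow> (nat \<Rightarrow> 'e) set" where
  "path_space B =
     {x \<in> PiE {1..} (edges B). \<forall>n\<ge>1. src B (Suc n) (x (Suc n)) = rng B n (x n)}"

definition path_topology :: "('v, 'e, 'm) bratteli_scheme \<Rightarrow> (nat \<Rightarrow> 'e) topology" where
  "path_topology B =
     subtopology (product_topology (\<lambda>n. discrete_topology (edges B n)) {1..}) (path_space B)"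

text \<open>
  The edge list \<open>p\<close> is a path from level \<open>i\<close> to level \<open>j\<close>: its entry \<open>p ! k\<close> is an edge of
  level \<open>i + k + 1\<close>.
\<close>
definition finite_paths ::
    "('v, 'e, 'm) bratteli_scheme \<Rightarrow> nat \<Rightarrow> nat \<Rightarrow> 'e list set" where
  "finite_paths B i j =
     {p. length p = j - i \<and>
         (\<forall>k<length p. p ! k \<in> edges B (i + k + 1)) \<and>
         (\<forall>k. Suc k < length p \<longrightarrow>
            src B (i + k + 2) (p ! Suc k) = rng B (i + k + 1) (p ! k))}"

definition telescope ::
    "('v, 'e, 'm) bratteli_scheme \<Rightarrow> (nat \<Rightarrow> nat) \<Rightarrow> ('v, 'e list) bratteli" where
  "telescope B \<nu> =
     \<lparr>vertices = (\<lambda>k. vertices B (\<nu> k)),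
      edges = (\<lambda>k. finite_paths B (\<nu> (k - 1)) (\<nu> k)),
      src = (\<lambda>k p. src B (\<nu> (k - 1) + 1) (hd p)),
      rng = (\<lambda>k p. rng B (\<nu> k) (last p))\<rparr>"

definition simple_diagram :: "('v, 'e, 'm) bratteli_scheme \<Rightarrow> bool" where
  "simple_diagram B \<longleftrightarrow>
     (\<exists>\<nu>. strict_mono \<nu> \<and> \<nu> 0 = 0 \<and>
        (let T = telescope B \<nu> in
           \<forall>n\<ge>1. \<forall>a\<in>vertices T n. \<forall>b\<in>vertices T (Suc n).
             \<exists>e\<in>edges T (Suc n). src T (Suc n) e = a \<and> rng T (Suc n) e = b))"

definition edges_into :: "('v, 'e, 'm) bratteli_scheme \<Rightarrow> nat \<Rightarrow> 'v \<Rightarrow> 'e set" where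
  "edges_into B n a = {e \<in> edges B n. rng B n e = a}"

definition ordered_diagram :: "('v, 'e) ordered_bratteli \<Rightarrow> bool" where
  "ordered_diagram B \<longleftrightarrow>
     bratteli_diagram B \<and>
     (\<forall>n\<ge>1. \<forall>a\<in>vertices B n. linear_order_on (edges_into B n a) (eord B n a))"

definition max_edge :: "('v, 'e) ordered_bratteli \<Rightarrow> nat \<Rightarrow> 'e \<Rightarrow> bool" where
  "max_edge B n e \<longleftrightarrow>
     (\<forall>e'\<in>edges_into B n (rng B n e). (e', e) \<in> eord B n (rng B n e))"

definition min_edge :: "('v, 'e) ordered_bratteli \<Rightarrow> nat \<Rightarrow> 'e \<Rightarrow> bool" where
  "min_edge B n e \<longleftrightarrow>
     (\<forall>e'\<in>edges_into B n (rng B n e). (e, e') \<in> eord B n (rng B n e))"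

definition max_path :: "('v, 'e) ordered_bratteli \<Rightarrow> (nat \<Rightarrow> 'e) \<Rightarrow> bool" where
  "max_path B x \<longleftrightarrow> x \<in> path_space B \<and> (\<forall>n\<ge>1. max_edge B n (x n))"

definition min_path :: "('v, 'e) ordered_bratteli \<Rightarrow> (nat \<Rightarrow> 'e) \<Rightarrow> bool" where
  "min_path B x \<longleftrightarrow> x \<in> path_space B \<and> (\<forall>n\<ge>1. min_edge B n (x n))"

definition succ_edge :: "('v, 'e) ordered_bratteli \<Rightarrow> nat \<Rightarrow> 'e \<Rightarrow> 'e" where
  "succ_edge B n e =
     (let a = rng B n e; above = {z \<in> edges_into B n a. z \<noteq> e \<and> (e, z) \<in> eord B n a}
      in THE y. y \<in> above \<and> (\<forall>z\<in>above. (y, z) \<in> eord B n a))"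

text \<open>
  Meaningful only for semi-proper diagrams: the value on maximal paths is the unique minimal path.
\<close>
definition vershik_map :: "('v, 'e) ordered_bratteli \<Rightarrow> (nat \<Rightarrow> 'e) \<Rightarrow> nat \<Rightarrow> 'e" where
  "vershik_map B x =
     (if max_path B x then THE y. min_path B y
      else let k = (LEAST k. k \<ge> 1 \<and> \<not> max_edge B k (x k)) in
        THE y. y \<in> path_space B \<and> (\<forall>n>k. y n = x n) \<and> y k = succ_edge B k (x k) \<and>
               (\<forall>n. 1 \<le> n \<and> n < k \<longrightarrow> min_edge B n (y n)))"

definition semi_proper :: "('v, 'e) ordered_bratteli \<Rightarrow> bool" where
  "semi_proper B \<longleftrightarrow> ordered_diagram B \<and> simple_diagram B \<and> (\<exists>!x. min_path B x)"

text \<open>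
  The maps \<open>f n\<close> identify consecutive vertex sets of levels \<open>\<ge> 1\<close> (hence all of them, by
  composition), and the maps \<open>g n\<close> are the induced identifications of the ordered edge sets of
  levels \<open>\<ge> 2\<close>.
\<close>
definition stationary :: "('v, 'e) ordered_bratteli \<Rightarrow> bool" where
  "stationary B \<longleftrightarrow>
     (\<exists>f g.
        (\<forall>n\<ge>1. bij_betw (f n) (vertices B n) (vertices B (Suc n))) \<and>
        (\<forall>n\<ge>2. bij_betw (g n) (edges B n) (edges B (Suc n)) \<and>
           (\<forall>e\<in>edges B n.
              src B (Suc n) (g n e) = f (n - 1) (src B n e) \<and>
              rng B (Suc n) (g n e) = f n (rng B n e)) \<and>
           (\<forall>a\<in>vertices B n. \<forall>e\<in>edges_into B n a. \<forall>e'\<in>edges_into B n a.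
              (e, e') \<in> eord B n a \<longleftrightarrow> (g n e, g n e') \<in> eord B (Suc n) (f n a))))"


section \<open>Topological conjugacy\<close>

definition topologically_conjugate ::
    "'x topology \<Rightarrow> ('x \<Rightarrow> 'x) \<Rightarrow> 'y topology \<Rightarrow> ('y \<Rightarrow> 'y) \<Rightarrow> bool" where
  "topologically_conjugate X f Y g \<longleftrightarrow>
     (\<exists>h. homeomorphic_map X Y h \<and> (\<forall>x\<in>topspace X. h (f x) = g (h x)))"

end

(*
Let X be the subshift, s the shift, and y0 the branch point, with P the set of letters a such that
a y0 lies in X. By recognizability no tau(a) is a suffix of another tau(b) with a, b in P; hence
w tau(y0) has two preimages, where w is a shortest longest common suffix of two of these words, and
so y0 = w tau(y0). Let Y be the cylinder of a prefix of y0 so long that its left extensions all lie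
in P. Then T y = w tau(y) maps Y into itself. Since orbits merge only at y0, which lies in Y and in
T(Y), every point of X lies in exactly one level of the towers over Y given by the return words;
recognizability shows that T carries the first return map of Y to that of T(Y). The diagram has the
return words to Y as vertices; an edge at level 1 is a position in such a word, and an edge at a
later level is a position among the return words that T(y) runs through before its return to T(Y).
Injectivity of the coding follows from its equivariance, since the first edge determines the first
letter.
*)
theory Submission
  imports Defs
begin

section \<open>A Bratteli diagram for a self-induced system\<close>

text \<open>The shift on \<open>X\<close> is onto but not invertible, so a point could have several
  tower addresses. Different addresses can only come from orbits that merge, and the single merging
  point is kept in the base of every tower. The map that carries one base to the next must therefore
  fix \<open>y0\<close>; prepending \<open>w\<close> to the image achieves this. The cylinder must
  also control the letters to its left: as \<open>w\<close> is a suffix of the image of every letter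
  that precedes a point of \<open>Y\<close>, the word \<open>w\<close> can be pushed through the
  image of a return word, so the orbit of \<open>T y\<close> meets \<open>T (S y)\<close>. Each
  tower is then built from the one before by the same rule, whence stationarity. An address is a
  mixed-radix expansion. Applying the map adds one with carry, which is what the Vershik map does to
  paths. The powers of \<open>T\<close> shrink \<open>Y\<close> towards \<open>y0\<close>, and after
  finitely many steps all of \<open>Y\<close> has the label of \<open>y0\<close>. This gives the
  unique minimal path and, with recurrence, simplicity. Maximal paths may be many: they code the
  points that the shift sends to \<open>y0\<close>.\<close>

lemma closedin_UN: "\<lbrakk>finite I; \<And>i. i \<in> I \<Longrightarrow> closedin X (C i)\<rbrakk> \<Longrightarrow> closedin X (\<Union>i\<in>I. C i)"
  by (rule closedin_Union) auto

lemma closedin_funpow_image: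
  assumes "compact_space X" "Hausdorff_space X" "continuous_map X X f" "closedin X F"
  shows "closedin X ((f ^^ n) ` F)"
proof (induction n)
  case (Suc n)
  have "closed_map X X f" using continuous_imp_closed_map assms by blast
  then have "closedin X (f ` (f ^^ n) ` F)" using Suc by (simp add: closed_map_def)
  then show ?case by (simp add: image_comp)
qed (use assms in simp)

lemma closedin_continuous_image:
  assumes "compact_space X" "Hausdorff_space Z" "closedin X Y"
    and "continuous_map (subtopology X Y) Z g" "closedin X F" "F \<subseteq> Y"
  shows "closedin Z (g ` F)"
proof -
  have "compact_space (subtopology X Y)"
    using assms by (simp add: closedin_compact_space compact_space_subtopology)
  then have "closed_map (subtopology X Y) Z g" using continuous_imp_closed_map assms by blast
  moreover have "closedin (subtopology X Y) F"
    using assms by (simp add: closedin_closed_subtopology)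
  ultimately show ?thesis by (simp add: closed_map_def)
qed

text \<open>
  \<open>S\<close> is the map induced by \<open>f\<close> on \<open>Y\<close>, with return time \<open>q\<close>, and \<open>T\<close> conjugates \<open>S\<close> to the map
  that \<open>S\<close> in turn induces on \<open>T ` Y\<close>, with return time \<open>m\<close>. Hence the towers over \<open>T ` Y\<close>, \<open>T ` T ` Y\<close>,
  \<open>\<dots>\<close> are all built from the previous one by the same rule.
\<close>
locale self_induced_system =
  fixes X :: "'x topology" and f :: "'x \<Rightarrow> 'x" and Y :: "'x set" and T :: "'x \<Rightarrow> 'x"
    and \<rho> :: "'x \<Rightarrow> nat" and q m :: "'x \<Rightarrow> nat" and S :: "'x \<Rightarrow> 'x" and y0 :: 'x
  assumes S_def: "S y = (f ^^ q y) y"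
    and compact_X: "compact_space X" and Hausdorff_X: "Hausdorff_space X"
    and continuous_f: "continuous_map X X f"
    and closed_Y: "closedin X Y"
    and continuous_T: "continuous_map (subtopology X Y) X T"
    and T_mem: "y \<in> Y \<Longrightarrow> T y \<in> Y"
    and closed_label: "closedin X {y \<in> Y. \<rho> y = a}"
    and finite_labels: "finite (\<rho> ` Y)"
    and q_pos: "y \<in> Y \<Longrightarrow> 0 < q y"
    and m_pos: "y \<in> Y \<Longrightarrow> 0 < m y"
    and S_mem: "y \<in> Y \<Longrightarrow> S y \<in> Y"
    and TS: "y \<in> Y \<Longrightarrow> T (S y) = (S ^^ m y) (T y)"
    and q_label: "\<lbrakk>y \<in> Y; z \<in> Y; \<rho> y = \<rho> z\<rbrakk> \<Longrightarrow> q y = q z"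
    and m_label: "\<lbrakk>y \<in> Y; z \<in> Y; \<rho> y = \<rho> z\<rbrakk> \<Longrightarrow> m y = m z"
    and label_induced: "\<lbrakk>y \<in> Y; z \<in> Y; \<rho> y = \<rho> z; k < m y\<rbrakk> \<Longrightarrow>
          \<rho> ((S ^^ k) (T y)) = \<rho> ((S ^^ k) (T z))"
    and tower0: "x \<in> topspace X \<Longrightarrow> \<exists>!p. fst p \<in> Y \<and> snd p < q (fst p) \<and> x = (f ^^ snd p) (fst p)"
    and tower: "y \<in> Y \<Longrightarrow> \<exists>!p. fst p \<in> Y \<and> snd p < m (fst p) \<and> y = (S ^^ snd p) (T (fst p))"
    and y0_mem: "y0 \<in> Y" and T_y0: "T y0 = y0"
    and label_contract: "\<exists>n. \<forall>y\<in>Y. \<rho> ((T ^^ n) y) = \<rho> y0"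
    and recurrent: "y \<in> Y \<Longrightarrow> \<exists>i. (f ^^ i) y0 \<in> Y \<and> \<rho> ((f ^^ i) y0) = \<rho> y"
    and separating: "\<lbrakk>x \<in> topspace X; x' \<in> topspace X;
          \<And>i. \<exists>y\<in>Y. \<exists>y'\<in>Y. \<exists>k<q y. \<rho> y = \<rho> y' \<and> (f ^^ i) x = (f ^^ k) y \<and> (f ^^ i) x' = (f ^^ k) y'\<rbrakk>
          \<Longrightarrow> x = x'"
begin

section \<open>Addresses of points in the nested towers\<close>

lemma Y_sub: "y \<in> Y \<Longrightarrow> y \<in> topspace X"
  using closed_Y closedin_subset by blast

lemma f_mem: "x \<in> topspace X \<Longrightarrow> f x \<in> topspace X"
  using continuous_f by (auto simp: continuous_map_def)

lemma f_pow_mem: "x \<in> topspace X \<Longrightarrow> (f ^^ n) x \<in> topspace X"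
  by (induction n) (auto intro: f_mem)

lemma S_pow_mem: "y \<in> Y \<Longrightarrow> (S ^^ n) y \<in> Y"
  by (induction n) (auto intro: S_mem)

lemma T_pow_mem: "y \<in> Y \<Longrightarrow> (T ^^ n) y \<in> Y"
  by (induction n) (auto intro: T_mem)

definition dec0 :: "'x \<Rightarrow> 'x \<times> nat" where
  "dec0 x = (THE p. fst p \<in> Y \<and> snd p < q (fst p) \<and> x = (f ^^ snd p) (fst p))"

definition dec :: "'x \<Rightarrow> 'x \<times> nat" where
  "dec y = (THE p. fst p \<in> Y \<and> snd p < m (fst p) \<and> y = (S ^^ snd p) (T (fst p)))"

lemma dec0:
  assumes "x \<in> topspace X"
  shows "fst (dec0 x) \<in> Y" "snd (dec0 x) < q (fst (dec0 x))" "(f ^^ snd (dec0 x)) (fst (dec0 x)) = x"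
  using theI'[OF tower0[OF assms]] unfolding dec0_def by auto

lemma dec0_eqI: "\<lbrakk>y \<in> Y; k < q y\<rbrakk> \<Longrightarrow> dec0 ((f ^^ k) y) = (y, k)"
  unfolding dec0_def by (rule the1_equality[OF tower0]) (auto intro: f_pow_mem Y_sub)

lemma dec:
  assumes "y \<in> Y"
  shows "fst (dec y) \<in> Y" "snd (dec y) < m (fst (dec y))" "(S ^^ snd (dec y)) (T (fst (dec y))) = y"
  using theI'[OF tower[OF assms]] unfolding dec_def by auto

lemma dec_eqI: "\<lbrakk>y \<in> Y; k < m y\<rbrakk> \<Longrightarrow> dec ((S ^^ k) (T y)) = (y, k)"
  unfolding dec_def by (rule the1_equality[OF tower]) (auto intro: S_pow_mem T_mem)

text \<open>\<open>dec\<close> undoes \<open>T\<close> on the bottom of a tower, so each level is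
  again read off in \<open>Y\<close> by the same rule. The heights \<open>ht x n\<close> are the
  digits of a mixed-radix expansion of \<open>x\<close>, whose radix depends on the base point
  \<open>lv x n\<close>.\<close>

primrec lev :: "'x \<Rightarrow> nat \<Rightarrow> 'x \<times> nat" where
  "lev x 0 = dec0 x"
| "lev x (Suc n) = dec (fst (lev x n))"

definition lv :: "'x \<Rightarrow> nat \<Rightarrow> 'x" where "lv x n = fst (lev x n)"
definition ht :: "'x \<Rightarrow> nat \<Rightarrow> nat" where "ht x n = snd (lev x n)"

text \<open>Only digit 0 counts steps of \<open>f\<close>, up to the return time \<open>q\<close>;
  later digits count steps of \<open>S\<close>, up to \<open>m\<close>. This switch is why the
  diagram repeats itself only from edge level 2 on.\<close>

definition height :: "nat \<Rightarrow> 'x \<Rightarrow> nat" where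
  "height n y = (if n = 0 then q y else m y)"

lemma height_pos: "y \<in> Y \<Longrightarrow> 0 < height n y"
  by (simp add: height_def q_pos m_pos)

lemma height_label: "\<lbrakk>y \<in> Y; z \<in> Y; \<rho> y = \<rho> z\<rbrakk> \<Longrightarrow> height n y = height n z"
  using q_label[of y z] m_label[of y z] by (simp add: height_def)

lemma lv_mem: "x \<in> topspace X \<Longrightarrow> lv x n \<in> Y"
  by (induction n) (auto simp: lv_def intro: dec0 dec)

lemma ht_less: "x \<in> topspace X \<Longrightarrow> ht x n < height n (lv x n)"
  using lv_mem[of x "n - 1"] by (cases n) (auto simp: lv_def ht_def height_def intro: dec0 dec)

lemma lv_0: "x \<in> topspace X \<Longrightarrow> (f ^^ ht x 0) (lv x 0) = x"
  using dec0 by (auto simp: lv_def ht_def)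

lemma lv_Suc: "x \<in> topspace X \<Longrightarrow> (S ^^ ht x (Suc n)) (T (lv x (Suc n))) = lv x n"
  using dec lv_mem[of x n] by (auto simp: lv_def ht_def)

text \<open>Addresses are unique at each level, so a guessed expansion only has to be checked:
  admissible digits that reproduce the point are its digits.\<close>

lemma lev_eqI:
  assumes "\<And>i. i \<le> n \<Longrightarrow> y i \<in> Y" "\<And>i. i \<le> n \<Longrightarrow> k i < height i (y i)"
    and "x = (f ^^ k 0) (y 0)" "\<And>i. i < n \<Longrightarrow> y i = (S ^^ k (Suc i)) (T (y (Suc i)))"
    and "i \<le> n"
  shows "lv x i = y i \<and> ht x i = k i"
  using \<open>i \<le> n\<close>
proof (induction i)
  case 0
  show ?case using dec0_eqI[of "y 0" "k 0"] assms(1,2)[of 0] assms(3)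
    by (simp add: lv_def ht_def height_def)
next
  case (Suc i)
  then have "lv x i = (S ^^ k (Suc i)) (T (y (Suc i)))" using assms(4)[of i] by simp
  then show ?case
    using dec_eqI[of "y (Suc i)" "k (Suc i)"] assms(1,2)[of "Suc i"] Suc.prems
    by (simp add: lv_def ht_def height_def)
qed

lemma lev_mem_eq:
  assumes "y \<in> Y" shows "lv y 0 = y" "ht y 0 = 0"
  using dec0_eqI[of y 0] assms q_pos by (auto simp: lv_def ht_def)

definition carry :: "'x \<Rightarrow> nat \<Rightarrow> bool" where
  "carry x i \<longleftrightarrow> (\<forall>j<i. Suc (ht x j) = height j (lv x j))"

text \<open>Adding one in a mixed-radix system: \<open>carry x i\<close> says that the carry reaches digit \<open>i\<close>.\<close>
lemma lev_f:
  assumes x: "x \<in> topspace X"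
  shows "lv (f x) i = (if carry x (Suc i) then S (lv x i) else lv x i) \<and>
         ht (f x) i = (if carry x (Suc i) then 0 else if carry x i then Suc (ht x i) else ht x i)"
proof -
  let ?y = "\<lambda>i. if carry x (Suc i) then S (lv x i) else lv x i"
  let ?k = "\<lambda>i. if carry x (Suc i) then 0 else if carry x i then Suc (ht x i) else ht x i"
  have carry_Suc: "carry x (Suc i) \<longleftrightarrow> carry x i \<and> Suc (ht x i) = height i (lv x i)" for i
    by (auto simp: carry_def less_Suc_eq)
  have 1: "?y i \<in> Y" for i using lv_mem[OF x] S_mem by auto
  have 2: "?k i < height i (?y i)" for i
    using ht_less[OF x, of i] height_pos[OF S_mem[OF lv_mem[OF x]]] by (auto simp: carry_Suc)
  \<comment> \<open>From the top of a level-0 tower, one step of \<open>f\<close> completes the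
    return, which is one step of \<open>S\<close>.\<close>
  have f_S: "f ((f ^^ k) y) = S y" if "Suc k = q y" for k y
    using that by (simp add: S_def flip: that)
  have 3: "f x = (f ^^ ?k 0) (?y 0)"
    using lv_0[OF x] f_S[of "ht x 0" "lv x 0"]
    by (auto simp: carry_Suc carry_def[of _ 0] height_def)
  have 4: "?y i = (S ^^ ?k (Suc i)) (T (?y (Suc i)))" for i
  proof (cases "carry x (Suc i)")
    case c: True
    have e: "S (lv x i) = (S ^^ Suc (ht x (Suc i))) (T (lv x (Suc i)))"
      using lv_Suc[OF x, of i] by simp
    show ?thesis
    proof (cases "carry x (Suc (Suc i))")
      case True
      then have "Suc (ht x (Suc i)) = m (lv x (Suc i))" by (simp add: carry_Suc height_def)
      \<comment> \<open>The tower is exhausted: \<open>TS\<close> rewrites the full climb as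
        \<open>T\<close> of the next base point, that is, digit 0 above it.\<close>
      then show ?thesis using e True c TS[OF lv_mem[OF x]] by simp
    next
      case False
      then show ?thesis using e c by simp
    qed
  next
    case False
    then have "\<not> carry x (Suc (Suc i))" using carry_Suc[of "Suc i"] by simp
    then show ?thesis using False lv_Suc[OF x, of i] by simp
  qed
  define y where "y = ?y"
  define k where "k = ?k"
  have "lv (f x) i = y i \<and> ht (f x) i = k i"
  proof (rule lev_eqI[of i])
    show "y j \<in> Y" "k j < height j (y j)" "y j = (S ^^ k (Suc j)) (T (y (Suc j)))" for j
      unfolding y_def k_def by (rule 1, rule 2, rule 4)
    show "f x = (f ^^ k 0) (y 0)" unfolding y_def k_def by (rule 3)
  qed simp
  then show ?thesis unfolding y_def k_def .
qed

section \<open>The ordered diagram of labels and positions\<close>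

definition rep :: "nat \<Rightarrow> 'x" where "rep = inv_into Y \<rho>"

lemma rep: "a \<in> \<rho> ` Y \<Longrightarrow> rep a \<in> Y \<and> \<rho> (rep a) = a"
  by (auto simp: rep_def f_inv_into_f intro: inv_into_into)

text \<open>An edge is its range label together with a position in the tower of that label, encoded
  as one number. Edge levels start at 1 and digits at 0, hence \<open>n - 1\<close>. The
  representative is harmless, since tower heights depend only on the label.\<close>

definition edge_set :: "nat \<Rightarrow> nat set" where
  "edge_set n = prod_encode ` {(a, k). a \<in> \<rho> ` Y \<and> k < height (n - 1) (rep a)}"

text \<open>Positions are times along a tower, so passing to the next edge with the same range means
  moving one step up.\<close>

definition diagram :: "(nat, nat) ordered_bratteli" where
  "diagram =
    \<lparr>vertices = (\<lambda>n. if n = 0 then {0} else \<rho> ` Y),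
     edges = edge_set,
     src = (\<lambda>n e. if n = 1 then 0
       else \<rho> ((S ^^ snd (prod_decode e)) (T (rep (fst (prod_decode e)))))),
     rng = (\<lambda>n e. fst (prod_decode e)),
     eord = (\<lambda>n a. {(e, e'). e \<in> edge_set n \<and> e' \<in> edge_set n \<and> fst (prod_decode e) = a \<and>
       fst (prod_decode e') = a \<and> snd (prod_decode e) \<le> snd (prod_decode e')})\<rparr>"

text \<open>The edge of level \<open>n\<close> records digit \<open>n - 1\<close>. At index 0 the
  value is \<open>undefined\<close>, as the extensional product in \<open>path_space\<close>
  requires.\<close>

definition code :: "'x \<Rightarrow> nat \<Rightarrow> nat" where
  "code x = (\<lambda>n\<in>{1..}. prod_encode (\<rho> (lv x (n - 1)), ht x (n - 1)))"

lemma q_rep: "y \<in> Y \<Longrightarrow> q (rep (\<rho> y)) = q y"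
  using q_label rep by blast

lemma m_rep: "y \<in> Y \<Longrightarrow> m (rep (\<rho> y)) = m y"
  using m_label rep by blast

lemma edge_iff: "prod_encode (a, k) \<in> edge_set n \<longleftrightarrow> a \<in> \<rho> ` Y \<and> k < height (n - 1) (rep a)"
  by (auto simp: edge_set_def)

lemma edgeE:
  assumes "e \<in> edge_set n"
  obtains y k where "e = prod_encode (\<rho> y, k)" "y \<in> Y" "k < height (n - 1) y"
proof -
  obtain a k where "e = prod_encode (a, k)" "a \<in> \<rho> ` Y" "k < height (n - 1) (rep a)"
    using assms by (auto simp: edge_set_def)
  then show thesis using that[of "rep a" k] rep[of a] by simp
qed

lemma edgeI: "\<lbrakk>y \<in> Y; k < height (n - 1) y\<rbrakk> \<Longrightarrow> prod_encode (\<rho> y, k) \<in> edge_set n"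
  using rep[of "\<rho> y"] height_label[of y "rep (\<rho> y)"] by (auto simp: edge_iff)

text \<open>\<open>label_induced\<close> allows any point with the given label in place of the
  chosen representative.\<close>

lemma src_diagram:
  assumes "y \<in> Y" "k < m y"
  shows "src diagram (Suc (Suc n)) (prod_encode (\<rho> y, k)) = \<rho> ((S ^^ k) (T y))"
  using label_induced[of y "rep (\<rho> y)" k] rep[of "\<rho> y"] assms by (simp add: diagram_def)

lemma finite_edges: "finite (edge_set n)"
proof -
  have "{(a, k). a \<in> \<rho> ` Y \<and> k < height (n - 1) (rep a)} = (SIGMA a:\<rho> ` Y. {..<height (n - 1) (rep a)})"
    by auto
  then show ?thesis using finite_labels by (simp add: edge_set_def)
qed

lemma bratteli_diagram: "bratteli_diagram diagram"
  unfolding bratteli_diagram_def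
proof (intro conjI allI ballI impI)
  show "finite (vertices diagram n)" for n using finite_labels by (simp add: diagram_def)
  show "finite (edges diagram n)" for n using finite_edges by (simp add: diagram_def)
  show "\<exists>v\<^sub>0. vertices diagram 0 = {v\<^sub>0}" by (simp add: diagram_def)
  fix n
  show "src diagram (Suc n) e \<in> vertices diagram n" "rng diagram (Suc n) e \<in> vertices diagram (Suc n)"
    if "e \<in> edges diagram (Suc n)" for e
  proof -
    have "e \<in> edge_set (Suc n)" using that by (simp add: diagram_def)
    then obtain y k where e: "e = prod_encode (\<rho> y, k)" "y \<in> Y" "k < height n y"
      by (metis edgeE diff_Suc_1)
    show "rng diagram (Suc n) e \<in> vertices diagram (Suc n)" using e by (simp add: diagram_def)
    show "src diagram (Suc n) e \<in> vertices diagram n"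
    proof (cases n)
      case 0 then show ?thesis by (simp add: diagram_def)
    next
      case (Suc n')
      then have "src diagram (Suc n) e = \<rho> ((S ^^ k) (T y))"
        using e src_diagram[of y k n'] by (simp add: height_def)
      then show ?thesis using e Suc S_pow_mem T_mem by (simp add: diagram_def)
    qed
  qed
  show "\<exists>e\<in>edges diagram (Suc n). src diagram (Suc n) e = v" if v: "v \<in> vertices diagram n" for v
  proof (cases n)
    case 0
    then have "prod_encode (\<rho> y0, 0) \<in> edges diagram (Suc n)" "src diagram (Suc n) (prod_encode (\<rho> y0, 0)) = v"
      using v edgeI[OF y0_mem height_pos[OF y0_mem]] by (auto simp: diagram_def)
    then show ?thesis by blast
  next
    case (Suc n')
    then obtain y where y: "y \<in> Y" "v = \<rho> y" using v by (auto simp: diagram_def)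
    \<comment> \<open>An edge out of the label of \<open>y\<close> comes from the address of
      \<open>y\<close> itself: the digit is its position, and its range is the label of the point
      whose \<open>T\<close>-image starts the tower.\<close>
    have d: "fst (dec y) \<in> Y" "snd (dec y) < m (fst (dec y))" using dec[OF y(1)] by auto
    have "prod_encode (\<rho> (fst (dec y)), snd (dec y)) \<in> edges diagram (Suc n)"
      using edgeI[of "fst (dec y)" "snd (dec y)" "Suc n"] d Suc by (simp add: diagram_def height_def)
    moreover have "src diagram (Suc n) (prod_encode (\<rho> (fst (dec y)), snd (dec y))) = v"
      using src_diagram[OF d, of n'] dec(3)[OF y(1)] y Suc by simp
    ultimately show ?thesis by blast
  qed
  show "\<exists>e\<in>edges diagram n. rng diagram n e = v" if v: "1 \<le> n" "v \<in> vertices diagram n" for v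
  proof -
    obtain y where y: "y \<in> Y" "v = \<rho> y" using v by (auto simp: diagram_def)
    have "prod_encode (\<rho> y, 0) \<in> edges diagram n" "rng diagram n (prod_encode (\<rho> y, 0)) = v"
      using edgeI[OF y(1) height_pos[OF y(1)]] y by (auto simp: diagram_def)
    then show ?thesis by blast
  qed
qed

lemma edges_into_diagram: "edges_into diagram n a = {e \<in> edge_set n. fst (prod_decode e) = a}"
  by (simp add: edges_into_def diagram_def)

lemma ordered_diagram: "ordered_diagram diagram"
proof -
  have eq: "e = e'" if "fst (prod_decode e) = fst (prod_decode e')" "snd (prod_decode e) = snd (prod_decode e')" for e e'
    using that by (metis prod_decode_eq prod_eq_iff)
  have "linear_order_on (edges_into diagram n a) (eord diagram n a)" for n a
    unfolding linear_order_on_def partial_order_on_def preorder_on_def edges_into_diagram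
  proof (intro conjI)
    show "antisym (eord diagram n a)"
      by (rule antisymI) (auto simp: diagram_def intro: eq)
  qed (auto simp: diagram_def refl_on_def trans_def total_on_def)
  then show ?thesis using bratteli_diagram by (simp add: ordered_diagram_def)
qed

lemma stationary_diagram: "stationary diagram"
  unfolding stationary_def
proof (intro exI conjI allI impI ballI)
  fix n :: nat assume "n \<ge> 1"
  then show "bij_betw (\<lambda>v. v) (vertices diagram n) (vertices diagram (Suc n))"
    by (simp add: diagram_def bij_betw_def)
next
  fix n :: nat assume n: "n \<ge> 2"
  \<comment> \<open>For \<open>n \<ge> 2\<close> both edge sets are cut out by \<open>m\<close>, so
    all identifications can be identities.\<close>
  have e: "edge_set (Suc n) = edge_set n" using n by (simp add: edge_set_def height_def)
  show "bij_betw (\<lambda>e. e) (edges diagram n) (edges diagram (Suc n))"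
    using e by (simp add: diagram_def bij_betw_def)
  show "src diagram (Suc n) x = src diagram n x" for x using n by (simp add: diagram_def)
  show "rng diagram (Suc n) x = rng diagram n x" for x using n by (simp add: diagram_def)
  show "((x, y) \<in> eord diagram n a) = ((x, y) \<in> eord diagram (Suc n) a)" for x y a
    using e by (simp add: diagram_def)
qed

lemma rng_diagram: "rng diagram n e = fst (prod_decode e)"
  by (simp add: diagram_def)

lemma eord_diagram:
  "(e, e') \<in> eord diagram n a \<longleftrightarrow> e \<in> edges_into diagram n a \<and> e' \<in> edges_into diagram n a \<and>
     snd (prod_decode e) \<le> snd (prod_decode e')"
  by (auto simp: edges_into_diagram) (auto simp: diagram_def)

lemma edges_into_iff:
  assumes "y \<in> Y"
  shows "e \<in> edges_into diagram n (\<rho> y) \<longleftrightarrow> (\<exists>k<height (n - 1) y. e = prod_encode (\<rho> y, k))"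
proof
  assume "e \<in> edges_into diagram n (\<rho> y)"
  then have e: "e \<in> edge_set n" "fst (prod_decode e) = \<rho> y" by (auto simp: edges_into_diagram)
  obtain z k where "e = prod_encode (\<rho> z, k)" "z \<in> Y" "k < height (n - 1) z" using edgeE[OF e(1)] .
  then show "\<exists>k<height (n - 1) y. e = prod_encode (\<rho> y, k)"
    using e(2) height_label[of z y "n - 1"] assms by auto
next
  assume "\<exists>k<height (n - 1) y. e = prod_encode (\<rho> y, k)"
  then show "e \<in> edges_into diagram n (\<rho> y)"
    using edgeI[OF assms, of _ n] by (auto simp: edges_into_diagram)
qed

lemma edges_into_eq:
  "y \<in> Y \<Longrightarrow> edges_into diagram n (\<rho> y) = (\<lambda>k. prod_encode (\<rho> y, k)) ` {..<height (n - 1) y}"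
  using edges_into_iff by blast

lemma min_edge_iff:
  assumes "y \<in> Y" "k < height (n - 1) y"
  shows "min_edge diagram n (prod_encode (\<rho> y, k)) \<longleftrightarrow> k = 0"
proof -
  have "min_edge diagram n (prod_encode (\<rho> y, k)) \<longleftrightarrow> (\<forall>j\<in>{..<height (n - 1) y}. k \<le> j)"
    using assms by (simp add: min_edge_def rng_diagram eord_diagram edges_into_eq)
  also have "\<dots> \<longleftrightarrow> k = 0" using assms(2) by (cases "height (n - 1) y") auto
  finally show ?thesis .
qed

lemma max_edge_iff:
  assumes "y \<in> Y" "k < height (n - 1) y"
  shows "max_edge diagram n (prod_encode (\<rho> y, k)) \<longleftrightarrow> Suc k = height (n - 1) y"
proof -
  have "max_edge diagram n (prod_encode (\<rho> y, k)) \<longleftrightarrow> (\<forall>j\<in>{..<height (n - 1) y}. j \<le> k)"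
    using assms by (simp add: max_edge_def rng_diagram eord_diagram edges_into_eq)
  also have "\<dots> \<longleftrightarrow> Suc k = height (n - 1) y" using assms(2) by (cases "height (n - 1) y") (auto simp: less_Suc_eq_le intro: le_antisym)
  finally show ?thesis .
qed

lemma succ_edge_eq:
  assumes "y \<in> Y" "Suc k < height (n - 1) y"
  shows "succ_edge diagram n (prod_encode (\<rho> y, k)) = prod_encode (\<rho> y, Suc k)"
proof -
  let ?above = "{z \<in> edges_into diagram n (\<rho> y). z \<noteq> prod_encode (\<rho> y, k) \<and>
    (prod_encode (\<rho> y, k), z) \<in> eord diagram n (\<rho> y)}"
  have above: "?above = {prod_encode (\<rho> y, j) | j. k < j \<and> j < height (n - 1) y}"
    using assms by (auto simp: eord_diagram edges_into_eq)
  have "(THE z. z \<in> ?above \<and> (\<forall>z'\<in>?above. (z, z') \<in> eord diagram n (\<rho> y))) = prod_encode (\<rho> y, Suc k)"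
    unfolding above
  proof (rule the_equality)
    show "prod_encode (\<rho> y, Suc k) \<in> {prod_encode (\<rho> y, j) | j. k < j \<and> j < height (n - 1) y} \<and>
      (\<forall>z'\<in>{prod_encode (\<rho> y, j) | j. k < j \<and> j < height (n - 1) y}.
         (prod_encode (\<rho> y, Suc k), z') \<in> eord diagram n (\<rho> y))"
      using assms by (auto simp: eord_diagram edges_into_eq)
  next
    fix z assume z: "z \<in> {prod_encode (\<rho> y, j) | j. k < j \<and> j < height (n - 1) y} \<and>
      (\<forall>z'\<in>{prod_encode (\<rho> y, j) | j. k < j \<and> j < height (n - 1) y}. (z, z') \<in> eord diagram n (\<rho> y))"
    then obtain j where j: "z = prod_encode (\<rho> y, j)" "k < j" by blast
    have "(z, prod_encode (\<rho> y, Suc k)) \<in> eord diagram n (\<rho> y)" using z assms(2) by blast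
    then show "z = prod_encode (\<rho> y, Suc k)" using j by (simp add: eord_diagram)
  qed
  then show ?thesis by (simp add: succ_edge_def Let_def rng_diagram)
qed

section \<open>Coding points by infinite paths\<close>

lemma code_Suc: "code x (Suc n) = prod_encode (\<rho> (lv x n), ht x n)"
  by (simp add: code_def)

lemma code_path:
  assumes "x \<in> topspace X" shows "code x \<in> path_space diagram"
proof -
  have "code x n \<in> edges diagram n" if "1 \<le> n" for n
    using edgeI[OF lv_mem[OF assms, of "n - 1"] ht_less[OF assms, of "n - 1"]] that
    by (simp add: code_def diagram_def)
  moreover have "src diagram (Suc n) (code x (Suc n)) = rng diagram n (code x n)" if n: "1 \<le> n" for n
  proof -
    obtain j where j: "n = Suc j" using n by (cases n) auto
    have "ht x (Suc j) < m (lv x (Suc j))" using ht_less[OF assms, of "Suc j"] by (simp add: height_def)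
    then show ?thesis
      using src_diagram[OF lv_mem[OF assms], of "ht x (Suc j)" "Suc j" j] lv_Suc[OF assms, of j]
      by (simp add: code_Suc j) (simp add: diagram_def)
  qed
  ultimately show ?thesis by (auto simp: path_space_def code_def)
qed

lemma path_edge:
  assumes "p \<in> path_space diagram"
  obtains y k where "p (Suc n) = prod_encode (\<rho> y, k)" "y \<in> Y" "k < height n y"
proof -
  have "p (Suc n) \<in> edge_set (Suc n)" using assms by (auto simp: path_space_def diagram_def)
  then show thesis by (rule edgeE) (use that in auto)
qed

lemma path_src:
  assumes "p \<in> path_space diagram" "p (Suc (Suc n)) = prod_encode (\<rho> y, k)" "y \<in> Y" "k < m y"
  shows "fst (prod_decode (p (Suc n))) = \<rho> ((S ^^ k) (T y))"
proof -
  have "src diagram (Suc (Suc n)) (p (Suc (Suc n))) = rng diagram (Suc n) (p (Suc n))"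
    using assms(1) by (simp add: path_space_def)
  then show ?thesis using assms src_diagram[of y k n] by (simp add: diagram_def)
qed

lemma path_eqI:
  assumes "p \<in> path_space diagram" "p' \<in> path_space diagram" "\<And>n. p (Suc n) = p' (Suc n)"
  shows "p = p'"
proof
  fix n show "p n = p' n"
    using assms by (cases n) (auto simp: path_space_def PiE_def extensional_def)
qed

text \<open>A minimal edge is determined by its range, which is the source of the edge above it, so
  agreement at one level spreads to all levels below. This supplies the uniqueness behind the
  description operator in \<open>vershik_map\<close>.\<close>

lemma path_below:
  assumes "p \<in> path_space diagram" "p' \<in> path_space diagram" "p (Suc n) = p' (Suc n)"
    and "\<And>i. i < n \<Longrightarrow> min_edge diagram (Suc i) (p (Suc i))"
    and "\<And>i. i < n \<Longrightarrow> min_edge diagram (Suc i) (p' (Suc i))" and "i \<le> n"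
  shows "p (Suc i) = p' (Suc i)"
  using \<open>i \<le> n\<close>
proof (induction rule: inc_induct)
  case base show ?case by fact
next
  case (step i)
  obtain y k where y: "p (Suc (Suc i)) = prod_encode (\<rho> y, k)" "y \<in> Y" "k < m y"
    using path_edge[OF assms(1), of "Suc i"] by (auto simp: height_def)
  have s: "fst (prod_decode (p (Suc i))) = fst (prod_decode (p' (Suc i)))"
    using path_src[OF assms(1) y] path_src[OF assms(2) _ y(2,3)] y(1) step.IH by simp
  obtain z j where z: "p (Suc i) = prod_encode (\<rho> z, j)" "z \<in> Y" "j < height i z"
    using path_edge[OF assms(1)] .
  obtain z' j' where z': "p' (Suc i) = prod_encode (\<rho> z', j')" "z' \<in> Y" "j' < height i z'"
    using path_edge[OF assms(2)] .
  have "j = 0" using assms(4)[OF step.hyps(2)] z min_edge_iff[of z j "Suc i"] by simp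
  moreover have "j' = 0" using assms(5)[OF step.hyps(2)] z' min_edge_iff[of z' j' "Suc i"] by simp
  ultimately show ?case using s z z' by simp
qed

lemma code_min_edge: "x \<in> topspace X \<Longrightarrow> min_edge diagram (Suc n) (code x (Suc n)) \<longleftrightarrow> ht x n = 0"
  using min_edge_iff[OF lv_mem, of x "ht x n" "Suc n" n] ht_less[of x n] by (simp add: code_Suc)

lemma code_max_edge:
  "x \<in> topspace X \<Longrightarrow> max_edge diagram (Suc n) (code x (Suc n)) \<longleftrightarrow> Suc (ht x n) = height n (lv x n)"
  using max_edge_iff[OF lv_mem, of x "ht x n" "Suc n" n] ht_less[of x n] by (simp add: code_Suc)

lemma min_path_code: "x \<in> topspace X \<Longrightarrow> min_path diagram (code x) \<longleftrightarrow> (\<forall>n. ht x n = 0)"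
  using code_min_edge code_path by (auto simp: min_path_def) (metis Suc_le_D)

lemma max_path_code: "x \<in> topspace X \<Longrightarrow> max_path diagram (code x) \<longleftrightarrow> (\<forall>n. carry x n)"
  using code_max_edge code_path by (auto simp: max_path_def carry_def) (metis One_nat_def Suc_le_D lessI)

text \<open>\<open>T z\<close> is the bottom of the tower over \<open>z\<close>, so each further
  level strips one \<open>T\<close> and contributes digit 0.\<close>

lemma lev_T_pow:
  assumes "y \<in> Y" "i \<le> n" shows "lv ((T ^^ n) y) i = (T ^^ (n - i)) y" "ht ((T ^^ n) y) i = 0"
proof -
  have "lv ((T ^^ n) y) i = (T ^^ (n - i)) y \<and> ht ((T ^^ n) y) i = 0"
    using lev_eqI[of n "\<lambda>i. (T ^^ (n - i)) y" "\<lambda>_. 0" "(T ^^ n) y" i] assms T_pow_mem height_pos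
    by (simp add: Suc_diff_Suc flip: funpow.simps(2) comp_apply[of T])
  then show "lv ((T ^^ n) y) i = (T ^^ (n - i)) y" "ht ((T ^^ n) y) i = 0" by auto
qed

lemma T_pow_y0: "(T ^^ n) y0 = y0" by (induction n) (auto simp: T_y0)

lemma lev_y0: "lv y0 n = y0" "ht y0 n = 0"
  using lev_T_pow[OF y0_mem, of n n] T_pow_y0 by auto

lemma min_path_y0: "min_path diagram (code y0)"
  using min_path_code[OF Y_sub[OF y0_mem]] lev_y0 by simp

text \<open>Going down one minimal edge replaces a base point \<open>y\<close> by
  \<open>T y\<close>, because the edge at position 0 has source label
  \<open>\<rho> (T y)\<close>.\<close>

lemma min_path_label:
  assumes "min_path diagram p" "y \<in> Y" "p (Suc (n + i)) = prod_encode (\<rho> y, k)"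
  shows "p (Suc i) = prod_encode (\<rho> ((T ^^ n) y), 0)"
  using assms(2,3)
proof (induction n arbitrary: y k)
  case 0
  have p: "p \<in> path_space diagram" using assms(1) by (simp add: min_path_def)
  obtain z j where z: "p (Suc i) = prod_encode (\<rho> z, j)" "z \<in> Y" "j < height i z"
    using path_edge[OF p] .
  have "min_edge diagram (Suc i) (p (Suc i))" using assms(1) by (simp add: min_path_def)
  then have "j = 0" using z min_edge_iff[of z j "Suc i"] by simp
  then show ?case using z 0 by simp
next
  case (Suc n)
  have p: "p \<in> path_space diagram" using assms(1) by (simp add: min_path_def)
  have zero: "j = 0" if "p (Suc l) = prod_encode (\<rho> z, j)" "z \<in> Y" "j < height l z" for l z j
  proof -
    have "min_edge diagram (Suc l) (p (Suc l))" using assms(1) by (simp add: min_path_def)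
    then show ?thesis using that min_edge_iff[of z j "Suc l"] by simp
  qed
  obtain z j where z: "p (Suc (Suc (n + i))) = prod_encode (\<rho> z, j)" "z \<in> Y" "j < height (Suc (n + i)) z"
    using path_edge[OF p] .
  have "j = 0" using zero[OF z] .
  have "\<rho> z = \<rho> y" "k = 0" using z Suc.prems \<open>j = 0\<close> by auto
  then have "fst (prod_decode (p (Suc (n + i)))) = \<rho> (T y)"
    using path_src[OF p, of "n + i" y k] Suc.prems m_pos by simp
  moreover obtain z' j' where z': "p (Suc (n + i)) = prod_encode (\<rho> z', j')" "z' \<in> Y" "j' < height (n + i) z'"
    using path_edge[OF p] .
  ultimately have "p (Suc (n + i)) = prod_encode (\<rho> (T y), j')" by simp
  then show ?case using Suc.IH[of "T y" j'] T_mem Suc.prems(1) by (simp add: funpow_swap1)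
qed

text \<open>Look \<open>n\<close> levels higher, with \<open>n\<close> from
  \<open>label_contract\<close>: whatever label is found there, descending \<open>n\<close> minimal
  edges leads to \<open>\<rho> y0\<close>.\<close>

lemma min_path_unique:
  assumes "min_path diagram p" shows "p = code y0"
proof (rule path_eqI)
  show p: "p \<in> path_space diagram" using assms by (simp add: min_path_def)
  show "code y0 \<in> path_space diagram" using code_path Y_sub y0_mem by simp
  fix i
  obtain n where n: "\<And>y. y \<in> Y \<Longrightarrow> \<rho> ((T ^^ n) y) = \<rho> y0" using label_contract by blast
  obtain y k where "p (Suc (n + i)) = prod_encode (\<rho> y, k)" "y \<in> Y" using path_edge[OF p] .
  then have "p (Suc i) = prod_encode (\<rho> y0, 0)" using min_path_label[OF assms] n by simp
  then show "p (Suc i) = code y0 (Suc i)" by (simp add: code_Suc lev_y0)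
qed

text \<open>In \<open>lev_f\<close> the carry stops at the first edge that is not maximal: the
  digits below become 0, this one grows by one, the rest stays. If it never stops, all digits of
  \<open>f x\<close> are 0, and this is the value prescribed on maximal paths.\<close>

lemma vershik_code:
  assumes x: "x \<in> topspace X" shows "vershik_map diagram (code x) = code (f x)"
proof (cases "max_path diagram (code x)")
  case True
  then have "carry x n" for n using max_path_code[OF x] by simp
  then have "min_path diagram (code (f x))" using lev_f[OF x] min_path_code[OF f_mem[OF x]] by simp
  moreover from this have "p = code (f x)" if "min_path diagram p" for p
    using min_path_unique that by metis
  ultimately have "(THE p. min_path diagram p) = code (f x)"
    by (intro the_equality)
  then show ?thesis using True by (simp add: vershik_map_def)
next
  case False
  let ?P = "\<lambda>k. 1 \<le> k \<and> \<not> max_edge diagram k (code x k)"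
  define k where "k = (LEAST k. ?P k)"
  have "\<exists>k. ?P k" using False code_path[OF x] by (auto simp: max_path_def)
  then have k: "?P k" unfolding k_def by (rule LeastI_ex)
  have below: "\<not> ?P i" if "i < k" for i using not_less_Least that unfolding k_def by blast
  obtain j where j: "k = Suc j" using k by (cases k) auto
  have carry: "carry x i \<longleftrightarrow> i \<le> j" for i
  proof
    assume c: "carry x i"
    show "i \<le> j"
    proof (rule ccontr)
      assume "\<not> i \<le> j"
      then have "Suc (ht x j) = height j (lv x j)" using c by (simp add: carry_def)
      then show False using k code_max_edge[OF x, of j] j by simp
    qed
  next
    assume i: "i \<le> j"
    show "carry x i" unfolding carry_def
    proof (intro allI impI)
      fix l assume "l < i"
      then have "max_edge diagram (Suc l) (code x (Suc l))" using below[of "Suc l"] i j by simp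
      then show "Suc (ht x l) = height l (lv x l)" using code_max_edge[OF x] by simp
    qed
  qed
  have above: "code (f x) n = code x n" if n: "n > k" for n
  proof -
    obtain i where "n = Suc i" "i > j" using n j by (cases n) auto
    then show ?thesis using lev_f[OF x, of i] carry by (simp add: code_Suc)
  qed
  have at: "code (f x) k = succ_edge diagram k (code x k)"
  proof -
    have "Suc (ht x j) < height j (lv x j)"
      using k code_max_edge[OF x, of j] ht_less[OF x, of j] j by simp
    then have "succ_edge diagram k (code x k) = prod_encode (\<rho> (lv x j), Suc (ht x j))"
      using succ_edge_eq[OF lv_mem[OF x], of "ht x j" k j] by (simp add: j code_Suc)
    then show ?thesis using lev_f[OF x, of j] carry by (simp add: code_Suc j)
  qed
  have low: "min_edge diagram n (code (f x) n)" if n: "1 \<le> n" "n < k" for n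
  proof -
    obtain i where "n = Suc i" "i < j" using n j by (cases n) auto
    then show ?thesis using lev_f[OF x, of i] carry code_min_edge[OF f_mem[OF x]] by simp
  qed
  have "(THE y. y \<in> path_space diagram \<and> (\<forall>n>k. y n = code x n) \<and> y k = succ_edge diagram k (code x k) \<and>
               (\<forall>n. 1 \<le> n \<and> n < k \<longrightarrow> min_edge diagram n (y n))) = code (f x)"
  proof (rule the_equality)
    fix p assume p: "p \<in> path_space diagram \<and> (\<forall>n>k. p n = code x n) \<and> p k = succ_edge diagram k (code x k) \<and>
               (\<forall>n. 1 \<le> n \<and> n < k \<longrightarrow> min_edge diagram n (p n))"
    have cf: "code (f x) \<in> path_space diagram" using code_path[OF f_mem[OF x]] .
    show "p = code (f x)"
    proof (rule path_eqI)
      fix n show "p (Suc n) = code (f x) (Suc n)"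
      proof (cases "n \<le> j")
        case True
        then show ?thesis using path_below[of p "code (f x)" j n] p cf at low j by auto
      next
        case False
        then show ?thesis using p above j by auto
      qed
    qed (use p cf in auto)
  qed (use above at low code_path[OF f_mem[OF x]] in auto)
  then show ?thesis using False unfolding vershik_map_def by (simp add: Let_def k_def)
qed

lemma code_inj:
  assumes x: "x \<in> topspace X" and x': "x' \<in> topspace X" and eq: "code x = code x'" shows "x = x'"
proof (rule separating[OF x x'])
  fix i
  have c: "code ((f ^^ i) x) = code ((f ^^ i) x')"
  proof (induction i)
    case (Suc i)
    then show ?case
      using vershik_code[OF f_pow_mem[OF x], of i] vershik_code[OF f_pow_mem[OF x'], of i] by simp
  qed (use eq in simp)
  have m: "(f ^^ i) x \<in> topspace X" "(f ^^ i) x' \<in> topspace X" using f_pow_mem x x' by auto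
  have "code ((f ^^ i) x) (Suc 0) = code ((f ^^ i) x') (Suc 0)" using c by simp
  then have "\<rho> (lv ((f ^^ i) x) 0) = \<rho> (lv ((f ^^ i) x') 0)" "ht ((f ^^ i) x) 0 = ht ((f ^^ i) x') 0"
    by (auto simp: code_Suc)
  then show "\<exists>y\<in>Y. \<exists>y'\<in>Y. \<exists>k<q y. \<rho> y = \<rho> y' \<and> (f ^^ i) x = (f ^^ k) y \<and> (f ^^ i) x' = (f ^^ k) y'"
    using lv_0[OF m(1)] lv_0[OF m(2)] lv_mem[OF m(1)] lv_mem[OF m(2)] ht_less[OF m(1), of 0]
    by (metis height_def)
qed

text \<open>Built downwards from the top: any base point with the right label may start, and it
  forces the base points below, whose labels match the path by \<open>path_src\<close>. The free
  choice of \<open>y\<close> is what later allows paths to be glued.\<close>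

lemma path_prefix_realized:
  assumes "p \<in> path_space diagram" "y \<in> Y" "fst (prod_decode (p (Suc n))) = \<rho> y"
  shows "\<exists>x\<in>topspace X. lv x n = y \<and> (\<forall>i\<le>n. code x (Suc i) = p (Suc i))"
  using assms(2,3)
proof (induction n arbitrary: y)
  case 0
  obtain z k where z: "p (Suc 0) = prod_encode (\<rho> z, k)" "z \<in> Y" "k < q z"
    using path_edge[OF assms(1), of 0] by (auto simp: height_def)
  then have "k < q y" using q_label[of z y] 0 by simp
  then have "dec0 ((f ^^ k) y) = (y, k)" using dec0_eqI 0 by simp
  then have "lv ((f ^^ k) y) 0 = y" "ht ((f ^^ k) y) 0 = k" by (auto simp: lv_def ht_def)
  then show ?case using z 0 f_pow_mem[OF Y_sub] by (intro bexI[of _ "(f ^^ k) y"]) (auto simp: code_Suc)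
next
  case (Suc n)
  obtain z k where z: "p (Suc (Suc n)) = prod_encode (\<rho> z, k)" "z \<in> Y" "k < m z"
    using path_edge[OF assms(1), of "Suc n"] by (auto simp: height_def)
  have zy: "\<rho> z = \<rho> y" using z Suc.prems by simp
  have k: "k < m y" using m_label[of z y] Suc.prems z zy by simp
  have "fst (prod_decode (p (Suc n))) = \<rho> ((S ^^ k) (T y))"
    using path_src[OF assms(1) _ Suc.prems(1) k] z zy by simp
  then obtain x where x: "x \<in> topspace X" "lv x n = (S ^^ k) (T y)" "\<forall>i\<le>n. code x (Suc i) = p (Suc i)"
    using Suc.IH[of "(S ^^ k) (T y)"] S_pow_mem T_mem Suc.prems by auto
  have "lv x (Suc n) = y" "ht x (Suc n) = k"
    using dec_eqI[OF Suc.prems(1) k] x(2) by (auto simp: lv_def ht_def)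
  moreover from this have "code x (Suc (Suc n)) = p (Suc (Suc n))" using z(1) zy by (simp add: code_Suc)
  ultimately show ?case using x by (metis le_Suc_eq)
qed

section \<open>Continuity and surjectivity of the coding\<close>

lemmas closed_f_pow = closedin_funpow_image[OF compact_X Hausdorff_X continuous_f]

lemmas closed_T = closedin_continuous_image[OF compact_X Hausdorff_X closed_Y continuous_T]

lemma closed_label_pred:
  assumes "closedin X F" "F \<subseteq> Y" shows "closedin X {y \<in> F. Q (\<rho> y)}"
proof -
  have "{y \<in> F. Q (\<rho> y)} = (\<Union>a \<in> {a \<in> \<rho> ` Y. Q a}. F \<inter> {y \<in> Y. \<rho> y = a})"
    using assms(2) by auto
  then show ?thesis using finite_labels closed_label assms(1)
    by (auto intro!: closedin_Union closedin_Int)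
qed

text \<open>On each of the finitely many label classes \<open>S\<close> is a fixed power of the
  closed map \<open>f\<close>.\<close>

lemma closed_S:
  assumes "closedin X F" "F \<subseteq> Y" shows "closedin X (S ` F)"
proof -
  have S: "S ` {y \<in> F. \<rho> y = a} = (f ^^ q (rep a)) ` {y \<in> F. \<rho> y = a}" for a
  proof (rule image_cong)
    fix y assume y: "y \<in> {y \<in> F. \<rho> y = a}"
    then have "q (rep a) = q y" using assms(2) q_rep by auto
    then show "S y = (f ^^ q (rep a)) y" by (simp add: S_def)
  qed simp
  have "F = (\<Union>a \<in> \<rho> ` Y. {y \<in> F. \<rho> y = a})" using assms(2) by auto
  then have "S ` F = (\<Union>a \<in> \<rho> ` Y. S ` {y \<in> F. \<rho> y = a})" by (metis image_UN)
  moreover have "closedin X (S ` {y \<in> F. \<rho> y = a})" for a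
    unfolding S by (rule closed_f_pow[OF closed_label_pred[OF assms]])
  ultimately show ?thesis using closedin_UN[OF finite_labels, of X "\<lambda>a. S ` {y \<in> F. \<rho> y = a}"] by simp
qed

lemma closed_S_pow:
  assumes "closedin X F" "F \<subseteq> Y" shows "closedin X ((S ^^ k) ` F)"
proof (induction k)
  case (Suc k)
  have "(S ^^ k) ` F \<subseteq> Y" using assms(2) S_pow_mem by auto
  then have "closedin X (S ` (S ^^ k) ` F)" using closed_S Suc by blast
  then show ?case by (simp add: image_comp)
qed (use assms in simp)

text \<open>Uniqueness of addresses turns this preimage into a forward image under
  \<open>f ^^ k\<close>, and closed maps carry closedness forward.\<close>

lemma closed_lev0:
  assumes "closedin X F" "F \<subseteq> Y"
  shows "closedin X {x \<in> topspace X. lv x 0 \<in> F \<and> ht x 0 = k}"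
proof -
  have "{x \<in> topspace X. lv x 0 \<in> F \<and> ht x 0 = k} = (f ^^ k) ` {y \<in> F. k < q (rep (\<rho> y))}"
    (is "?L = ?R")
  proof
    have q: "q (rep (\<rho> y)) = q y" if "y \<in> F" for y
      using q_rep that assms(2) by blast
    show "?L \<subseteq> ?R"
    proof
      fix x assume x: "x \<in> ?L"
      then have "k < q (lv x 0)" using ht_less[of x 0] by (simp add: height_def)
      then show "x \<in> ?R" using x lv_0[of x] q by (intro image_eqI[of _ _ "lv x 0"]) auto
    qed
    show "?R \<subseteq> ?L"
    proof
      fix x assume "x \<in> ?R"
      then obtain y where y: "y \<in> F" "k < q y" "x = (f ^^ k) y" using q by auto
      then show "x \<in> ?L" using dec0_eqI[of y k] assms(2) f_pow_mem[OF Y_sub]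
        by (auto simp: lv_def ht_def)
    qed
  qed
  moreover have "closedin X ((f ^^ k) ` {y \<in> F. k < q (rep (\<rho> y))})"
    by (rule closed_f_pow[OF closed_label_pred[OF assms]])
  ultimately show ?thesis by (simp only:)
qed

lemma closed_dec:
  assumes "closedin X F" "F \<subseteq> Y"
  shows "closedin X {y \<in> Y. fst (dec y) \<in> F \<and> snd (dec y) = k}"
proof -
  have eq: "{y \<in> Y. fst (dec y) \<in> F \<and> snd (dec y) = k} = (S ^^ k) ` T ` {y \<in> F. k < m (rep (\<rho> y))}"
    (is "?L = ?R")
  proof
    have q: "m (rep (\<rho> y)) = m y" if "y \<in> F" for y
      using m_rep that assms(2) by blast
    show "?L \<subseteq> ?R"
    proof
      fix x assume x: "x \<in> ?L"
      then show "x \<in> ?R" using dec[of x] q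
        by (auto simp: image_comp intro!: image_eqI[of _ _ "fst (dec x)"])
    qed
    show "?R \<subseteq> ?L"
    proof
      fix x assume "x \<in> ?R"
      then obtain y where y: "y \<in> F" "k < m y" "x = (S ^^ k) (T y)" using q by auto
      then show "x \<in> ?L" using dec_eqI[of y k] assms(2) S_pow_mem T_mem by auto
    qed
  qed
  have "closedin X {y \<in> F. k < m (rep (\<rho> y))}" by (rule closed_label_pred[OF assms])
  then have "closedin X (T ` {y \<in> F. k < m (rep (\<rho> y))})"
    using assms(2) by (rule closed_T[OF _ order.trans[rotated]]) auto
  moreover have "T ` {y \<in> F. k < m (rep (\<rho> y))} \<subseteq> Y" using T_mem assms(2) by auto
  ultimately have "closedin X ((S ^^ k) ` T ` {y \<in> F. k < m (rep (\<rho> y))})" by (rule closed_S_pow)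
  then show ?thesis using eq by (simp only:)
qed

lemma m_bound: "\<exists>M. \<forall>y\<in>Y. m y < M"
proof -
  have "m ` Y \<subseteq> (\<lambda>a. m (rep a)) ` \<rho> ` Y"
    using m_rep by (metis (no_types, lifting) image_eqI image_subsetI)
  then have "finite (m ` Y)" using finite_labels finite_subset by blast
  then show ?thesis by (metis finite_nat_set_iff_bounded imageI)
qed

lemma q_bound: "\<exists>M. \<forall>y\<in>Y. q y < M"
proof -
  have "q ` Y \<subseteq> (\<lambda>a. q (rep a)) ` \<rho> ` Y"
    using q_rep by (metis (no_types, lifting) image_eqI image_subsetI)
  then have "finite (q ` Y)" using finite_labels finite_subset by blast
  then show ?thesis by (metis finite_nat_set_iff_bounded imageI)
qed

text \<open>A condition on level \<open>Suc n\<close> is a condition on level \<open>n\<close>, with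
  \<open>F\<close> replaced by the points of \<open>Y\<close> whose next base point lies in
  \<open>F\<close>. That set is closed as a finite union over the digit; hence the induction over
  arbitrary \<open>F\<close>.\<close>

lemma closed_lv:
  assumes "closedin X F" "F \<subseteq> Y"
  shows "closedin X {x \<in> topspace X. lv x n \<in> F}"
  using assms
proof (induction n arbitrary: F)
  case 0
  obtain M where M: "\<And>y. y \<in> Y \<Longrightarrow> q y < M" using q_bound by blast
  have "{x \<in> topspace X. lv x 0 \<in> F} = (\<Union>k<M. {x \<in> topspace X. lv x 0 \<in> F \<and> ht x 0 = k})"
    using ht_less[of _ 0] M lv_mem[of _ 0] by (fastforce simp: height_def dest: order.strict_trans)
  moreover have "closedin X (\<Union>k<M. {x \<in> topspace X. lv x 0 \<in> F \<and> ht x 0 = k})"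
    by (intro closedin_UN closed_lev0[OF 0]) auto
  ultimately show ?case by (simp only:)
next
  case (Suc n)
  obtain M where M: "\<And>y. y \<in> Y \<Longrightarrow> m y < M" using m_bound by blast
  let ?G = "\<Union>k<M. {y \<in> Y. fst (dec y) \<in> F \<and> snd (dec y) = k}"
  have "closedin X ?G" using closed_dec[OF Suc.prems] by (intro closedin_UN) auto
  moreover have "?G \<subseteq> Y" by auto
  moreover have "snd (dec y) < M" if "y \<in> Y" for y
    using dec(1,2)[OF that] M by (meson order.strict_trans)
  then have "?G = {y \<in> Y. fst (dec y) \<in> F}" by auto
  ultimately have "closedin X {x \<in> topspace X. lv x n \<in> {y \<in> Y. fst (dec y) \<in> F}}" by (intro Suc.IH) (simp_all only:)
  moreover have "{x \<in> topspace X. lv x n \<in> {y \<in> Y. fst (dec y) \<in> F}} = {x \<in> topspace X. lv x (Suc n) \<in> F}"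
    using lv_mem by (auto simp: lv_def)
  ultimately show ?case by simp
qed

lemma closed_code: "closedin X {x \<in> topspace X. code x (Suc n) = e}"
proof -
  obtain a k where e: "e = prod_encode (a, k)" by (metis prod.exhaust prod_decode_inverse)
  let ?F = "{y \<in> Y. \<rho> y = a}"
  have F: "closedin X ?F" "?F \<subseteq> Y" using closed_label by auto
  have "{x \<in> topspace X. code x (Suc n) = e} = {x \<in> topspace X. lv x n \<in> ?F \<and> ht x n = k}"
    using lv_mem e by (auto simp: code_Suc)
  also have "closedin X \<dots>"
  proof (cases n)
    case 0 then show ?thesis using closed_lev0[OF F] by simp
  next
    case (Suc j)
    have "{x \<in> topspace X. lv x n \<in> ?F \<and> ht x n = k} =
        {x \<in> topspace X. lv x j \<in> {y \<in> Y. fst (dec y) \<in> ?F \<and> snd (dec y) = k}}"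
      using lv_mem[of _ j] by (auto simp: Suc lv_def ht_def)
    moreover have "closedin X {x \<in> topspace X. lv x j \<in> {y \<in> Y. fst (dec y) \<in> ?F \<and> snd (dec y) = k}}"
      by (rule closed_lv[OF closed_dec[OF F]]) auto
    ultimately show ?thesis by (simp only:)
  qed
  finally show ?thesis .
qed

text \<open>The points that realize longer and longer prefixes of \<open>p\<close> form nested
  nonempty closed sets, which have a common point by compactness.\<close>

lemma code_surj:
  assumes p: "p \<in> path_space diagram" shows "\<exists>x\<in>topspace X. code x = p"
proof -
  let ?C = "\<lambda>n. {x \<in> topspace X. \<forall>i\<le>n. code x (Suc i) = p (Suc i)}"
  have "(\<Inter>n. ?C n) \<noteq> {}"
  proof (rule compact_space_imp_nest[OF compact_X])
    fix n
    have "?C n = (\<Inter>i\<le>n. {x \<in> topspace X. code x (Suc i) = p (Suc i)})" by auto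
    then show "closedin X (?C n)" using closed_code by (auto intro!: closedin_Inter)
    obtain y k where "p (Suc n) = prod_encode (\<rho> y, k)" "y \<in> Y" using path_edge[OF p] .
    then show "?C n \<noteq> {}" using path_prefix_realized[OF p, of y n] by auto
  next
    show "decseq ?C" by (auto simp: decseq_def)
  qed
  then obtain x where "\<And>n. x \<in> ?C n" by blast
  then have "x \<in> topspace X" "\<And>n. code x (Suc n) = p (Suc n)" by blast+
  then show ?thesis using path_eqI[OF code_path p] by blast
qed

lemma topspace_path: "topspace (path_topology diagram) = path_space diagram"
  by (auto simp: path_topology_def path_space_def)

lemma homeomorphic_code: "homeomorphic_map X (path_topology diagram) code"
proof (rule continuous_imp_homeomorphic_map)
  show "compact_space X" by (rule compact_X)
  show "Hausdorff_space (path_topology diagram)"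
    by (auto simp: path_topology_def Hausdorff_space_product_topology Hausdorff_space_discrete_topology
        intro!: Hausdorff_space_subtopology)
  show "code ` topspace X = topspace (path_topology diagram)"
    using code_path code_surj by (force simp: topspace_path)
  show "inj_on code (topspace X)" using code_inj by (auto intro: inj_onI)
  have "continuous_map X (discrete_topology (edges diagram n)) (\<lambda>x. code x n)" if n: "n \<ge> 1" for n
    unfolding continuous_map_closedin
  proof (intro conjI allI impI)
    obtain j where j: "n = Suc j" using n by (cases n) auto
    show "(\<lambda>x. code x n) \<in> topspace X \<rightarrow> topspace (discrete_topology (edges diagram n))"
      using code_path n by (fastforce simp: path_space_def)
    fix C assume "closedin (discrete_topology (edges diagram n)) C"
    then have "finite C" using finite_edges finite_subset by (auto simp: diagram_def)
    moreover have "{x \<in> topspace X. code x n \<in> C} = (\<Union>e\<in>C. {x \<in> topspace X. code x n = e})" by auto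
    ultimately show "closedin X {x \<in> topspace X. code x n \<in> C}"
      using closed_code j by (auto intro: closedin_UN)
  qed
  then show "continuous_map X (path_topology diagram) code"
    using code_path
    by (auto simp: path_topology_def continuous_map_in_subtopology continuous_map_componentwise code_def)
qed

lemma conjugate: "topologically_conjugate (path_topology diagram) (vershik_map diagram) X f"
proof -
  obtain g where g: "homeomorphic_maps X (path_topology diagram) code g"
    using homeomorphic_code homeomorphic_map_maps by blast
  have "homeomorphic_map (path_topology diagram) X g"
    using g homeomorphic_maps_map by blast
  moreover have "g (vershik_map diagram p) = f (g p)" if p: "p \<in> topspace (path_topology diagram)" for p
  proof -
    have "g p \<in> topspace X" "code (g p) = p"
      using g p by (auto simp: homeomorphic_maps_def continuous_map_def)
    then have "vershik_map diagram p = code (f (g p))" using vershik_code by metis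
    then show ?thesis using g f_mem \<open>g p \<in> topspace X\<close> by (simp add: homeomorphic_maps_def)
  qed
  ultimately show ?thesis unfolding topologically_conjugate_def by blast
qed

section \<open>Simplicity of the diagram\<close>

lemma code_tail_orbit: "\<exists>n0. \<forall>n\<ge>n0. \<rho> (lv ((f ^^ i) y0) n) = \<rho> y0 \<and> ht ((f ^^ i) y0) n = 0"
proof (induction i)
  case 0 show ?case by (simp add: lev_y0)
next
  case (Suc i)
  let ?x = "(f ^^ i) y0"
  have x: "?x \<in> topspace X" using f_pow_mem Y_sub y0_mem by blast
  show ?case
  \<comment> \<open>An endless carry leaves only digits 0, so \<open>f ?x\<close> is
    \<open>y0\<close> by injectivity of the coding. A carry that stops leaves the digits beyond it
    alone.\<close>
  proof (cases "\<forall>n. carry ?x n")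
    case True
    then have "min_path diagram (code (f ?x))"
      using lev_f[OF x] min_path_code[OF f_mem[OF x]] by simp
    then have "code (f ?x) = code y0" by (rule min_path_unique)
    then have "f ?x = y0" using code_inj f_mem[OF x] Y_sub y0_mem by blast
    then show ?thesis by (simp add: lev_y0)
  next
    case False
    then obtain j where j: "\<not> carry ?x j" by blast
    obtain n0 where n0: "\<forall>n\<ge>n0. \<rho> (lv ?x n) = \<rho> y0 \<and> ht ?x n = 0" using Suc by blast
    have "\<not> carry ?x n" if "n \<ge> j" for n using j that unfolding carry_def by (meson order_less_le_trans)
    then have "\<forall>n\<ge>max n0 j. \<rho> (lv ((f ^^ Suc i) y0) n) = \<rho> y0 \<and> ht ((f ^^ Suc i) y0) n = 0"
      using lev_f[OF x] n0 by auto
    then show ?thesis by blast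
  qed
qed

text \<open>Two pieces are glued at the label of \<open>y0\<close>. Below, the orbit of
  \<open>y0\<close> visits every label, and far up its points carry the label of \<open>y0\<close>
  again; above, \<open>n0\<close> edges at position 0 lead from \<open>\<rho> y0\<close> up to any
  label, by \<open>label_contract\<close>.\<close>

lemma labels_connected:
  "\<exists>M>0. \<forall>b\<in>\<rho> ` Y. \<forall>c\<in>\<rho> ` Y. \<exists>x\<in>topspace X. \<rho> (lv x 0) = b \<and> \<rho> (lv x M) = c"
proof -
  obtain n0 where n0: "\<And>y. y \<in> Y \<Longrightarrow> \<rho> ((T ^^ n0) y) = \<rho> y0" using label_contract by blast
  have "\<exists>n. \<forall>l\<ge>n. \<exists>x\<in>topspace X. \<rho> (lv x 0) = b \<and> \<rho> (lv x l) = \<rho> y0" if b: "b \<in> \<rho> ` Y" for b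
  proof -
    obtain i where i: "(f ^^ i) y0 \<in> Y" "\<rho> ((f ^^ i) y0) = b" using recurrent b by blast
    obtain n where "\<forall>l\<ge>n. \<rho> (lv ((f ^^ i) y0) l) = \<rho> y0" using code_tail_orbit by blast
    then show ?thesis using lev_mem_eq(1)[OF i(1)] i Y_sub by metis
  qed
  then obtain n where n: "\<And>b l. b \<in> \<rho> ` Y \<Longrightarrow> l \<ge> n b \<Longrightarrow>
      \<exists>x\<in>topspace X. \<rho> (lv x 0) = b \<and> \<rho> (lv x l) = \<rho> y0" by metis
  \<comment> \<open>There are finitely many labels, so one level serves them all; taking
    \<open>Suc N\<close> keeps the connecting length positive.\<close>
  obtain N where N: "\<And>b. b \<in> \<rho> ` Y \<Longrightarrow> n b \<le> N"
    using finite_labels by (metis finite_imageI finite_nat_set_iff_bounded_le imageI)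
  have "\<exists>x\<in>topspace X. \<rho> (lv x 0) = b \<and> \<rho> (lv x (Suc N + n0)) = c"
    if b: "b \<in> \<rho> ` Y" and c: "c \<in> \<rho> ` Y" for b c
  proof -
    obtain z where z: "z \<in> topspace X" "\<rho> (lv z 0) = b" "\<rho> (lv z (Suc N)) = \<rho> y0"
      using n[OF b, of "Suc N"] N[OF b] by auto
    obtain y where y: "y \<in> Y" "c = \<rho> y" using c by blast
    \<comment> \<open>The path of \<open>z\<close> is realized again, now over
      \<open>(T ^^ n0) y\<close>, which has the same label \<open>\<rho> y0\<close> at level
      \<open>Suc N\<close>.\<close>
    obtain x where x: "x \<in> topspace X" "lv x (Suc N) = (T ^^ n0) y"
        "\<forall>i\<le>Suc N. code x (Suc i) = code z (Suc i)"
      using path_prefix_realized[OF code_path[OF z(1)], of "(T ^^ n0) y" "Suc N"] n0[OF y(1)] z(3)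
        T_pow_mem[OF y(1)] by (auto simp: code_Suc)
    have "code x (Suc 0) = code z (Suc 0)" using x(3) by blast
    then have "\<rho> (lv x 0) = b" using z(2) by (simp add: code_Suc)
    moreover have "lv x (Suc N + i) = (T ^^ (n0 - i)) y" if "i \<le> n0" for i
      using that
    proof (induction i)
      case 0 then show ?case using x(2) by simp
    next
      case (Suc i)
      then have "lv x (Suc N + i) = (S ^^ 0) (T ((T ^^ (n0 - Suc i)) y))"
        by (simp add: Suc_diff_Suc flip: funpow.simps(2) comp_apply[of T])
      then have "dec (lv x (Suc N + i)) = ((T ^^ (n0 - Suc i)) y, 0)"
        using dec_eqI[of "(T ^^ (n0 - Suc i)) y" 0] T_pow_mem[OF y(1)] m_pos by simp
      then show ?case by (simp add: lv_def)
    qed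
    ultimately show ?thesis using x(1) y(2) by (intro bexI[of _ x]) auto
  qed
  then show ?thesis by (intro exI[of _ "Suc N + n0"]) auto
qed

lemma simple_diagram: "simple_diagram diagram"
proof -
  obtain M where M: "M > 0" and conn: "\<And>b c. b \<in> \<rho> ` Y \<Longrightarrow> c \<in> \<rho> ` Y \<Longrightarrow>
      \<exists>x\<in>topspace X. \<rho> (lv x 0) = b \<and> \<rho> (lv x M) = c"
    using labels_connected by blast
  define \<nu> where "\<nu> = (\<lambda>k. k * M)"
  have "\<exists>e\<in>edges (telescope diagram \<nu>) (Suc n). src (telescope diagram \<nu>) (Suc n) e = a \<and>
          rng (telescope diagram \<nu>) (Suc n) e = b"
    if n: "n \<ge> 1" and a: "a \<in> vertices (telescope diagram \<nu>) n"
      and b: "b \<in> vertices (telescope diagram \<nu>) (Suc n)" for n a b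
  proof -
    have pos: "n * M > 0" using M n by simp
    have ab: "a \<in> \<rho> ` Y" "b \<in> \<rho> ` Y" using a b pos M by (auto simp: telescope_def diagram_def \<nu>_def)
    obtain x where x: "x \<in> topspace X" "\<rho> (lv x 0) = a" "\<rho> (lv x M) = b" using conn[OF ab] by blast
    \<comment> \<open>These are the edges of levels 2 to \<open>M + 1\<close>, leading from the
      label of \<open>lv x 0\<close> to that of \<open>lv x M\<close>. By stationarity they also
      form a path from level \<open>n * M\<close> to level \<open>n * M + M\<close>.\<close>
    define p where "p = map (\<lambda>k. code x (k + 2)) [0..<M]"
    have len: "length p = M" by (simp add: p_def)
    have nth: "p ! k = code x (k + 2)" if "k < M" for k using that by (simp add: p_def)
    have code: "code x \<in> path_space diagram" using code_path x by blast
    have edges_eq: "edges diagram k = edges diagram 2" if "k \<ge> 2" for k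
      using that by (simp add: diagram_def edge_set_def height_def)
    have src_eq: "src diagram k = src diagram 2" if "k \<ge> 2" for k
      using that by (simp add: diagram_def)
    have rng_eq: "rng diagram k = rng diagram 2" for k by (simp add: diagram_def)
    have edge: "code x k \<in> edges diagram 2" if "k \<ge> 2" for k
      using code that edges_eq[OF that] by (auto simp: path_space_def)
    have adj: "src diagram 2 (code x (Suc k)) = rng diagram 2 (code x k)" if "k \<ge> 1" for k
      using code that src_eq[of "Suc k"] rng_eq[of k] by (auto simp: path_space_def)
    have "p \<in> finite_paths diagram (n * M) (n * M + M)"
      unfolding finite_paths_def
    proof (intro CollectI conjI allI impI)
      show "length p = n * M + M - n * M" by (simp add: len)
      show "p ! k \<in> edges diagram (n * M + k + 1)" if "k < length p" for k
        using edge[of "k + 2"] edges_eq[of "n * M + k + 1"] pos that by (simp add: nth len)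
      show "src diagram (n * M + k + 2) (p ! Suc k) = rng diagram (n * M + k + 1) (p ! k)"
        if "Suc k < length p" for k
        using adj[of "k + 2"] src_eq[of "n * M + k + 2"] rng_eq[of "n * M + k + 1"] that
        by (simp add: nth len)
    qed
    moreover have "src diagram (n * M + 1) (hd p) = a"
    proof -
      have "hd p = code x (Suc 1)" using nth[of 0] M len by (simp add: hd_conv_nth flip: length_greater_0_conv)
      then show ?thesis using adj[of 1] src_eq[of "n * M + 1"] pos x(2)
        by (simp add: code_Suc) (simp add: diagram_def)
    qed
    moreover have "rng diagram (n * M + M) (last p) = b"
    proof -
      have "last p = p ! (M - 1)" using M len by (metis last_conv_nth length_greater_0_conv)
      moreover have "M - 1 + 2 = Suc M" using M by simp
      ultimately have "last p = code x (Suc M)" using nth[of "M - 1"] M by simp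
      then show ?thesis using x(3) by (simp add: code_Suc diagram_def)
    qed
    ultimately show ?thesis
      by (intro bexI[of _ p]) (auto simp: telescope_def \<nu>_def add.commute)
  qed
  moreover have "strict_mono \<nu>" using M by (simp add: strict_mono_def \<nu>_def)
  ultimately show ?thesis unfolding simple_diagram_def Let_def by (intro exI[of _ \<nu>]) (auto simp: \<nu>_def)
qed

theorem bratteli_vershik_model:
  "semi_proper diagram" "stationary diagram"
  "topologically_conjugate (path_topology diagram) (vershik_map diagram) X f"
  using ordered_diagram simple_diagram min_path_y0 min_path_unique stationary_diagram conjugate
  by (auto simp: semi_proper_def)

end

section \<open>Words and one-sided sequences\<close>

definition conc :: "'a list \<Rightarrow> (nat \<Rightarrow> 'a) \<Rightarrow> nat \<Rightarrow> 'a" where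
  "conc w x = (\<lambda>i. if i < length w then w ! i else x (i - length w))"

lemma shift_pow: "(seq_shift ^^ n) x = (\<lambda>i. x (n + i))"
  by (induction n) (auto simp: seq_shift_def)

lemma length_prefix_word [simp]: "length (prefix_word x n) = n"
  by (simp add: prefix_word_def)

lemma nth_prefix_word [simp]: "i < n \<Longrightarrow> prefix_word x n ! i = x i"
  by (simp add: prefix_word_def)

lemma prefix_word_0 [simp]: "prefix_word x 0 = []"
  by (simp add: prefix_word_def)

lemma prefix_word_eq_iff: "prefix_word x n = prefix_word y n \<longleftrightarrow> (\<forall>i<n. x i = y i)"
  by (auto simp: prefix_word_def)

lemma prefix_word_mono: "\<lbrakk>prefix_word x n = prefix_word y n; m \<le> n\<rbrakk> \<Longrightarrow> prefix_word x m = prefix_word y m"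
  by (simp add: prefix_word_eq_iff)

lemma prefix_word_add: "prefix_word x (m + n) = prefix_word x m @ prefix_word ((seq_shift ^^ m) x) n"
  by (rule nth_equalityI) (auto simp: nth_append shift_pow)

lemma prefix_word_Suc: "prefix_word x (Suc n) = x 0 # prefix_word (seq_shift x) n"
  using prefix_word_add[of x 1 n] by (simp add: prefix_word_def)

lemma prefix_word_shift_eq:
  assumes "prefix_word x (m + n) = prefix_word y (m + n)"
  shows "prefix_word ((seq_shift ^^ m) x) n = prefix_word ((seq_shift ^^ m) y) n"
  using assms by (simp add: prefix_word_eq_iff shift_pow)

lemma map_upt_prefix_word: "map x [i..<i + n] = prefix_word ((seq_shift ^^ i) x) n"
  by (rule nth_equalityI) (auto simp: shift_pow)

lemma conc_Nil [simp]: "conc [] x = x"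
  by (simp add: conc_def)

lemma conc_append: "conc (v @ w) x = conc v (conc w x)"
  by (auto simp: conc_def nth_append fun_eq_iff)

lemma shift_conc: "(seq_shift ^^ length w) (conc w x) = x"
  by (auto simp: conc_def shift_pow)

lemma seq_shift_conc [simp]: "seq_shift (conc [a] x) = x"
  by (auto simp: conc_def seq_shift_def)

lemma conc_inj: "conc w x = conc w y \<Longrightarrow> x = y"
  by (metis shift_conc)

lemma conc_prefix_word: "conc (prefix_word x n) ((seq_shift ^^ n) x) = x"
  by (auto simp: conc_def shift_pow)

lemma prefix_word_conc: "prefix_word (conc w x) (length w + n) = w @ prefix_word x n"
  by (rule nth_equalityI) (auto simp: conc_def nth_append)

lemma prefix_word_conc_length: "prefix_word (conc w x) (length w) = w"
  using prefix_word_conc[of w x 0] by simp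

lemma conc_singleton_shift: "conc [x 0] (seq_shift x) = x"
  using conc_prefix_word[of x 1] by (simp add: prefix_word_def)

lemma subst_word_Nil [simp]: "subst_word \<tau> [] = []"
  by (simp add: subst_word_def)

lemma subst_word_Cons [simp]: "subst_word \<tau> (a # w) = \<tau> a @ subst_word \<tau> w"
  by (simp add: subst_word_def)

lemma subst_word_append [simp]: "subst_word \<tau> (v @ w) = subst_word \<tau> v @ subst_word \<tau> w"
  by (simp add: subst_word_def)

lemma sublist_subst_word: "sublist v w \<Longrightarrow> sublist (subst_word \<tau> v) (subst_word \<tau> w)"
  unfolding sublist_def by (metis subst_word_append)

lemma sublist_subst_word_pow: "sublist v w \<Longrightarrow> sublist ((subst_word \<tau> ^^ n) v) ((subst_word \<tau> ^^ n) w)"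
  by (induction n) (auto intro: sublist_subst_word)

lemma language_sublist: "\<lbrakk>w \<in> language \<tau>; sublist v w\<rbrakk> \<Longrightarrow> v \<in> language \<tau>"
  unfolding language_def by (blast intro: sublist_order.order.trans)

lemma language_subst_word:
  assumes "w \<in> language \<tau>" shows "subst_word \<tau> w \<in> language \<tau>"
proof -
  obtain n a where "n \<ge> 1" "sublist w (subst_power \<tau> n a)" using assms by (auto simp: language_def)
  then have "sublist (subst_word \<tau> w) (subst_power \<tau> (Suc n) a)"
    using sublist_subst_word by (simp add: subst_power_def)
  then show ?thesis unfolding language_def by (metis (mono_tags, lifting) le_SucI mem_Collect_eq \<open>n \<ge> 1\<close>)
qed

text \<open>A factor is a suffix of a prefix, and the language is closed under factors.\<close>

lemma subst_space_iff: "x \<in> subst_space \<tau> \<longleftrightarrow> (\<forall>n. prefix_word x n \<in> language \<tau>)"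
proof
  assume "x \<in> subst_space \<tau>"
  then have "map x [0..<0 + n] \<in> language \<tau>" for n unfolding subst_space_def factors_def by blast
  then show "\<forall>n. prefix_word x n \<in> language \<tau>" by (simp add: prefix_word_def)
next
  assume *: "\<forall>n. prefix_word x n \<in> language \<tau>"
  have "map x [i..<i + k] \<in> language \<tau>" for i k
    unfolding map_upt_prefix_word using * by (metis prefix_word_add language_sublist sublist_append_leftI)
  then show "x \<in> subst_space \<tau>" by (auto simp: subst_space_def factors_def)
qed

lemma subst_space_shift: "x \<in> subst_space \<tau> \<Longrightarrow> (seq_shift ^^ n) x \<in> subst_space \<tau>"
  unfolding subst_space_iff
  by (metis prefix_word_add language_sublist sublist_append_leftI)

lemma subst_space_conc_tail: "conc w x \<in> subst_space \<tau> \<Longrightarrow> x \<in> subst_space \<tau>"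
  using subst_space_shift[of "conc w x" \<tau> "length w"] by (simp add: shift_conc)

lemma length_subst_word: "substitution \<tau> \<Longrightarrow> length w \<le> length (subst_word \<tau> w)"
proof (induction w)
  case (Cons a w)
  then have "length (\<tau> a) > 0" by (simp add: substitution_def)
  moreover have "length w \<le> length (subst_word \<tau> w)" using Cons by simp
  ultimately show ?case unfolding subst_word_Cons length_append list.size(4) by linarith
qed simp

text \<open>Of two prefixes one extends the other, and so do their images; hence all prefixes whose
  image reaches position \<open>i\<close> show the same letter there.\<close>

lemma nth_subst_seq:
  assumes "substitution \<tau>" "i < length (subst_word \<tau> (prefix_word x n))"
  shows "subst_seq \<tau> x i = subst_word \<tau> (prefix_word x n) ! i"
proof -
  have i: "i < length (subst_word \<tau> (prefix_word x (Suc i)))"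
    using length_subst_word[OF assms(1), of "prefix_word x (Suc i)"] by simp
  show ?thesis
  proof (cases "n \<le> Suc i")
    case True
    then obtain d where "Suc i = n + d" using le_Suc_ex by blast
    then have "subst_word \<tau> (prefix_word x (Suc i)) ! i = subst_word \<tau> (prefix_word x n) ! i"
      using assms(2) by (simp add: prefix_word_add nth_append)
    then show ?thesis by (simp add: subst_seq_def)
  next
    case False
    then obtain d where "n = Suc i + d" using le_Suc_ex[of "Suc i" n] by auto
    then have "prefix_word x n = prefix_word x (Suc i) @ prefix_word ((seq_shift ^^ Suc i) x) d"
      by (simp only: prefix_word_add)
    then have "subst_word \<tau> (prefix_word x n) ! i = subst_word \<tau> (prefix_word x (Suc i)) ! i"
      using i by (simp only: subst_word_append nth_append if_True)
    then show ?thesis by (simp add: subst_seq_def)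
  qed
qed

lemma prefix_word_subst_seq:
  assumes "substitution \<tau>"
  shows "prefix_word (subst_seq \<tau> x) (length (subst_word \<tau> (prefix_word x n))) = subst_word \<tau> (prefix_word x n)"
  by (rule nth_equalityI) (auto simp: nth_subst_seq[OF assms])

lemma shift_subst_seq:
  assumes "substitution \<tau>"
  shows "(seq_shift ^^ length (subst_word \<tau> (prefix_word x n))) (subst_seq \<tau> x) = subst_seq \<tau> ((seq_shift ^^ n) x)"
proof
  fix i
  let ?y = "(seq_shift ^^ n) x" and ?l = "length (subst_word \<tau> (prefix_word x n))"
  have i: "i < length (subst_word \<tau> (prefix_word ?y (Suc i)))"
    using length_subst_word[OF assms, of "prefix_word ?y (Suc i)"] by simp
  then have "subst_seq \<tau> x (?l + i) = subst_word \<tau> (prefix_word x (n + Suc i)) ! (?l + i)"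
    using nth_subst_seq[OF assms, of "?l + i" x "n + Suc i"] by (simp only: prefix_word_add subst_word_append length_append)
  then show "(seq_shift ^^ ?l) (subst_seq \<tau> x) i = subst_seq \<tau> ?y i"
    by (simp add: shift_pow[of ?l] prefix_word_add subst_seq_def del: add_Suc_right)
qed

lemma subst_seq_conc:
  assumes "substitution \<tau>"
  shows "subst_seq \<tau> (conc w x) = conc (subst_word \<tau> w) (subst_seq \<tau> x)"
  using prefix_word_subst_seq[OF assms, of "conc w x" "length w"]
    shift_subst_seq[OF assms, of "conc w x" "length w"]
  by (simp add: prefix_word_conc_length shift_conc) (metis conc_prefix_word)

lemma subst_seq_decomp:
  assumes "substitution \<tau>"
  shows "subst_seq \<tau> x = conc (subst_word \<tau> (prefix_word x n)) (subst_seq \<tau> ((seq_shift ^^ n) x))"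
  using subst_seq_conc[OF assms] conc_prefix_word by metis

lemma subst_space_subst_seq:
  assumes "substitution \<tau>" "x \<in> subst_space \<tau>" shows "subst_seq \<tau> x \<in> subst_space \<tau>"
  unfolding subst_space_iff
proof
  fix n
  let ?w = "subst_word \<tau> (prefix_word x n)"
  have "n \<le> length ?w" using length_subst_word[OF assms(1), of "prefix_word x n"] by simp
  then obtain d where "length ?w = n + d" using le_Suc_ex by blast
  then have "?w = prefix_word (subst_seq \<tau> x) n @ prefix_word ((seq_shift ^^ n) (subst_seq \<tau> x)) d"
    using prefix_word_subst_seq[OF assms(1), of x n] by (simp add: prefix_word_add)
  moreover have "?w \<in> language \<tau>" 
    by (rule language_subst_word) (use assms(2) in \<open>simp add: subst_space_iff\<close>)
  ultimately show "prefix_word (subst_seq \<tau> x) n \<in> language \<tau>"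
    using language_sublist[of ?w \<tau> "prefix_word (subst_seq \<tau> x) n"] by (metis sublist_append_rightI)
qed

section \<open>Cylinders and the topology of the subshift\<close>

lemma topspace_seq [simp]: "topspace seq_topology = UNIV"
  by (simp add: seq_topology_def)

lemma openin_cylinder: "openin seq_topology {y. prefix_word y n = w}"
proof (cases "length w = n")
  case True
  have 1: "openin seq_topology {y. y i = a}" for i :: nat and a :: 'a
    using openin_continuous_map_preimage[OF continuous_map_product_projection[of i UNIV "\<lambda>_. discrete_topology UNIV"], of "{a}"]
    by (simp add: seq_topology_def)
  have "{y. prefix_word y n = w} = {y \<in> topspace seq_topology. \<forall>i\<in>{..<n}. y i = w ! i}"
    using True by (auto simp: list_eq_iff_nth_eq)
  also have "openin seq_topology \<dots>"
  proof (cases "n = 0")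
    case False
    then have "{y \<in> topspace seq_topology. \<forall>i\<in>{..<n}. y i = w ! i} = (\<Inter>i<n. {y. y i = w ! i})" by auto
    then show ?thesis using 1 False by (auto intro!: openin_Inter simp: lessThan_empty_iff)
  qed (simp flip: topspace_seq)
  finally show ?thesis .
next
  case False
  then have "{y. prefix_word y n = w} = {}" by auto
  then show ?thesis by simp
qed

text \<open>Such a set is the trace on \<open>A\<close> of a union of cylinders of length
  \<open>n\<close>.\<close>

lemma openin_prefix_determined:
  assumes "\<And>x y. \<lbrakk>x \<in> A; y \<in> A; prefix_word x n = prefix_word y n; P x\<rbrakk> \<Longrightarrow> P y"
  shows "openin (subtopology seq_topology A) {x \<in> A. P x}"
proof -
  let ?U = "\<Union>x\<in>{x \<in> A. P x}. {y. prefix_word y n = prefix_word x n}"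
  have "openin seq_topology ?U"
  proof (rule openin_Union)
    fix K assume "K \<in> (\<lambda>x. {y. prefix_word y n = prefix_word x n}) ` {x \<in> A. P x}"
    then obtain x where "K = {y. prefix_word y n = prefix_word x n}" by (elim imageE)
    then show "openin seq_topology K" by (simp only: openin_cylinder)
  qed
  moreover have "{x \<in> A. P x} = ?U \<inter> A"
  proof (intro set_eqI iffI)
    fix y assume "y \<in> ?U \<inter> A"
    then obtain x where "x \<in> A" "P x" "prefix_word x n = prefix_word y n" "y \<in> A" by auto
    then show "y \<in> {x \<in> A. P x}" using assms by blast
  qed auto
  ultimately show ?thesis unfolding openin_subtopology by blast
qed

lemma closedin_prefix_determined:
  assumes "\<And>x y. \<lbrakk>x \<in> A; y \<in> A; prefix_word x n = prefix_word y n; P x\<rbrakk> \<Longrightarrow> P y"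
  shows "closedin (subtopology seq_topology A) {x \<in> A. P x}"
proof -
  have "openin (subtopology seq_topology A) {x \<in> A. \<not> P x}"
  proof (rule openin_prefix_determined[of _ n])
    fix x y assume "x \<in> A" "y \<in> A" "prefix_word x n = prefix_word y n" "\<not> P x"
    then show "\<not> P y" using assms[of y x] by auto
  qed
  moreover have "A - {x \<in> A. P x} = {x \<in> A. \<not> P x}" by auto
  ultimately show ?thesis unfolding closedin_def by simp
qed

lemma continuous_prefix_determined:
  assumes "\<And>i. \<exists>n. \<forall>x\<in>A. \<forall>y\<in>A. prefix_word x n = prefix_word y n \<longrightarrow> g x i = g y i"
  shows "continuous_map (subtopology seq_topology A) seq_topology g"
proof -
  have "continuous_map (subtopology seq_topology A) (discrete_topology UNIV) (\<lambda>x. g x i)" for i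
  proof -
    obtain n where n: "\<forall>x\<in>A. \<forall>y\<in>A. prefix_word x n = prefix_word y n \<longrightarrow> g x i = g y i"
      using assms by blast
    have "openin (subtopology seq_topology A) {x \<in> A. g x i \<in> U}" for U
      using n by (intro openin_prefix_determined[of _ n]) metis
    then show ?thesis by (simp add: continuous_map_def)
  qed
  then show ?thesis
    unfolding seq_topology_def continuous_map_componentwise_UNIV by simp
qed

lemma Hausdorff_seq: "Hausdorff_space seq_topology"
  by (simp add: seq_topology_def Hausdorff_space_product_topology Hausdorff_space_discrete_topology)

lemma compact_seq: "compact_space (seq_topology :: (nat \<Rightarrow> 'a::finite) topology)"
  by (simp add: seq_topology_def compact_space_product_topology compact_space_discrete_topology)

lemma topspace_subst [simp]: "topspace (subst_topology \<tau>) = subst_space \<tau>"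
  by (simp add: subst_topology_def)

lemma closedin_subst_space: "closedin seq_topology (subst_space \<tau>)"
proof -
  have "closedin (subtopology seq_topology UNIV) {x \<in> UNIV. prefix_word x n \<in> language \<tau>}" for n
    by (rule closedin_prefix_determined[of _ n]) simp
  then have "closedin seq_topology {x. prefix_word x n \<in> language \<tau>}" for n by simp
  then have "closedin seq_topology (\<Inter>n. {x. prefix_word x n \<in> language \<tau>})"
    by (intro closedin_Inter) blast+
  moreover have "subst_space \<tau> = (\<Inter>n. {x. prefix_word x n \<in> language \<tau>})"
    by (auto simp: subst_space_iff)
  ultimately show ?thesis by simp
qed

lemma compact_subst: "compact_space (subst_topology (\<tau> :: 'a::finite \<Rightarrow> 'a list))"
  unfolding subst_topology_def
  by (intro compact_space_subtopology closedin_compact_space compact_seq closedin_subst_space)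

lemma Hausdorff_subst: "Hausdorff_space (subst_topology \<tau>)"
  by (simp add: subst_topology_def Hausdorff_seq Hausdorff_space_subtopology)

lemma continuous_shift: "continuous_map (subst_topology \<tau>) (subst_topology \<tau>) seq_shift"
proof -
  have "continuous_map (subst_topology \<tau>) seq_topology seq_shift"
    unfolding subst_topology_def
    by (rule continuous_prefix_determined) (auto simp: seq_shift_def prefix_word_eq_iff intro: exI[of _ "Suc (Suc i)" for i])
  then show ?thesis
    using subst_space_shift[of _ \<tau> 1] by (auto simp: subst_topology_def continuous_map_in_subtopology)
qed

text \<open>
  \<open>R y\<close> is the return time of \<open>b y\<close> to the base \<open>b ` Y\<close>. Two representations of a point can only
  arise by merging of orbits, hence at \<open>z\<^sub>0\<close>, which lies in the base.
\<close>
lemma tower_unique: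
  assumes g: "\<And>z. z \<in> Z \<Longrightarrow> g z \<in> Z" and b: "\<And>y. y \<in> Y \<Longrightarrow> b y \<in> Z" "inj_on b Y"
    and branch: "\<And>z z'. \<lbrakk>z \<in> Z; z' \<in> Z; g z = g z'; z \<noteq> z'\<rbrakk> \<Longrightarrow> g z = z\<^sub>0"
    and z0: "z\<^sub>0 \<in> b ` Y"
    and R_pos: "\<And>y. y \<in> Y \<Longrightarrow> 0 < R y" and R_return: "\<And>y. y \<in> Y \<Longrightarrow> (g ^^ R y) (b y) \<in> b ` Y"
    and R_least: "\<And>y i. \<lbrakk>y \<in> Y; 0 < i; i < R y\<rbrakk> \<Longrightarrow> (g ^^ i) (b y) \<notin> b ` Y"
    and ex: "\<exists>k. \<exists>y\<in>Y. z = (g ^^ k) (b y)"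
  shows "\<exists>!p. fst p \<in> Y \<and> snd p < R (fst p) \<and> z = (g ^^ snd p) (b (fst p))"
proof -
  \<comment> \<open>Reaching \<open>z\<close> in the fewest steps rules out
    \<open>R y \<le> k\<close>, since restarting at the return to the base would save steps.\<close>
  define k where "k = (LEAST k. \<exists>y\<in>Y. z = (g ^^ k) (b y))"
  obtain y where y: "y \<in> Y" "z = (g ^^ k) (b y)" using LeastI_ex[OF ex] unfolding k_def by blast
  have "k < R y"
  proof (rule ccontr)
    assume "\<not> k < R y"
    then have k: "k = (k - R y) + R y" by simp
    obtain y' where y': "y' \<in> Y" "(g ^^ R y) (b y) = b y'" using R_return[OF y(1)] by blast
    then have "z = (g ^^ (k - R y)) (b y')" using y(2) k by (metis comp_apply funpow_add)
    then have "k \<le> k - R y" unfolding k_def using y'(1) by (intro Least_le) blast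
    then show False using R_pos[OF y(1)] \<open>\<not> k < R y\<close> by simp
  qed
  have unique: "y = y' \<and> k = k'"
    if "y \<in> Y" "y' \<in> Y" "k' < R y'" "k < R y" "(g ^^ k) (b y) = (g ^^ k') (b y')" "k \<le> k'" for y y' k k'
  proof -
    \<comment> \<open>With the second orbit started \<open>d\<close> steps ahead, the two orbits
      agree at time \<open>k\<close>; let \<open>i\<close> be the first time they do. If
      \<open>i = 0\<close>, the second orbit is in the base at time \<open>d < R y'\<close>, so
      \<open>d = 0\<close>. Otherwise they merge at time \<open>i\<close>, so the first orbit meets
      the base point \<open>z\<^sub>0\<close> before its return.\<close>
    define d where "d = k' - k"
    let ?P = "\<lambda>i. (g ^^ i) (b y) = (g ^^ (i + d)) (b y')"
    have "?P k" using that by (simp add: d_def)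
    define i where "i = (LEAST i. ?P i)"
    have i: "?P i" unfolding i_def using \<open>?P k\<close> by (rule LeastI)
    have ik: "i \<le> k" unfolding i_def using \<open>?P k\<close> by (rule Least_le)
    show ?thesis
    proof (cases i)
      case 0
      then have "(g ^^ d) (b y') = b y" using i by simp
      moreover have "d < R y'" using that by (simp add: d_def)
      ultimately have "d = 0" using R_least[OF that(2), of d] that(1) by auto
      then show ?thesis using that(1,2,6) i 0 b(2) by (auto simp: d_def inj_on_def)
    next
      case (Suc j)
      have mem: "(g ^^ n) (b v) \<in> Z" if "v \<in> Y" for n v
        using that by (induction n) (auto intro: g b)
      have "\<not> ?P j" using not_less_Least[of j ?P] Suc unfolding i_def by simp
      then have "(g ^^ i) (b y) = z\<^sub>0" using branch[OF mem[OF that(1), of j] mem[OF that(2), of "j + d"]] i Suc by simp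
      then show ?thesis using R_least[OF that(1), of i] ik that(4) Suc z0 by simp
    qed
  qed
  show ?thesis
  proof (rule ex1I[of _ "(y, k)"])
    show "fst (y, k) \<in> Y \<and> snd (y, k) < R (fst (y, k)) \<and> z = (g ^^ snd (y, k)) (b (fst (y, k)))"
      using y \<open>k < R y\<close> by simp
    fix p assume p: "fst p \<in> Y \<and> snd p < R (fst p) \<and> z = (g ^^ snd p) (b (fst p))"
    then show "p = (y, k)"
      using unique[of y "fst p" "snd p" k] unique[of "fst p" y k "snd p"] y \<open>k < R y\<close>
      by (cases "k \<le> snd p") (auto simp: prod_eq_iff)
  qed
qed

section \<open>Recognizable minimal substitutions\<close>

locale subst_system =
  fixes \<tau> :: "'a::finite \<Rightarrow> 'a list" and u :: "nat \<Rightarrow> 'a"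
  assumes subst: "substitution \<tau>" and generating: "generating_fixed_point \<tau> u"
    and left_proper: "left_proper \<tau>"
    and minimal: "minimal_system (subst_topology \<tau>) seq_shift"
    and recognizable: "recognizable \<tau> u" and inj: "inj \<tau>"
begin

abbreviation X where "X \<equiv> subst_space \<tau>"

lemma fixed: "subst_seq \<tau> u = u"
  using generating by (simp add: generating_fixed_point_def fixed_point_def)

lemma language_factor: "w \<in> language \<tau> \<Longrightarrow> \<exists>i. prefix_word ((seq_shift ^^ i) u) (length w) = w"
proof -
  assume "w \<in> language \<tau>"
  then have "w \<in> factors u" using generating by (simp add: generating_fixed_point_def)
  then obtain i k where "w = map u [i..<i + k]" by (auto simp: factors_def)
  then have "w = prefix_word ((seq_shift ^^ i) u) k" by (simp add: map_upt_prefix_word)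
  then have "prefix_word ((seq_shift ^^ i) u) (length w) = w" by simp
  then show ?thesis ..
qed

text \<open>Equal images must be cut at the same places, since this is so for occurrences in \<open>u\<close>.\<close>
lemma image_shift_cut:
  assumes x: "x \<in> X" and y: "y \<in> X" and eq: "(seq_shift ^^ k) (subst_seq \<tau> x) = subst_seq \<tau> y"
  shows "\<exists>p. k = length (subst_word \<tau> (prefix_word x p))"
proof -
  let ?len = "\<lambda>x n. length (subst_word \<tau> (prefix_word x n))"
  obtain L where L: "\<And>i j. map u [i..<i + L] = map u [j..<j + L] \<Longrightarrow>
      i \<in> cut_points \<tau> u \<Longrightarrow> j \<in> cut_points \<tau> u"
    using recognizable unfolding recognizable_def by blast
  have cut_iff: "i \<in> cut_points \<tau> u \<longleftrightarrow> (\<exists>p. i = ?len u p)" for i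
  proof
    assume "i \<in> cut_points \<tau> u"
    then have "i = ?len u 0 \<or> (\<exists>p>0. i = ?len u p)" by (auto simp: cut_points_def)
    then show "\<exists>p. i = ?len u p" by blast
  next
    assume "\<exists>p. i = ?len u p"
    then obtain p where "i = ?len u p" ..
    then show "i \<in> cut_points \<tau> u" by (cases "p = 0") (auto simp: cut_points_def)
  qed
  have occ: "\<exists>i. prefix_word ((seq_shift ^^ i) u) n = prefix_word z n \<and>
      prefix_word ((seq_shift ^^ ?len u i) u) (?len z n) = prefix_word (subst_seq \<tau> z) (?len z n)"
    if z: "z \<in> X" for z n
  proof -
    obtain i where i: "prefix_word ((seq_shift ^^ i) u) n = prefix_word z n"
      using language_factor[of "prefix_word z n"] z by (auto simp: subst_space_iff)
    have "(seq_shift ^^ ?len u i) u = subst_seq \<tau> ((seq_shift ^^ i) u)"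
      using shift_subst_seq[OF subst, of u i] fixed by simp
    then have "prefix_word ((seq_shift ^^ ?len u i) u) (?len z n) = prefix_word (subst_seq \<tau> z) (?len z n)"
      using prefix_word_subst_seq[OF subst, of z n] prefix_word_subst_seq[OF subst, of "(seq_shift ^^ i) u" n] i
      by simp
    then show ?thesis using i by blast
  qed
  \<comment> \<open>\<open>k + L\<close> letters of \<open>x\<close> suffice: their image covers the
    window of length \<open>L\<close> at position \<open>k\<close>, and a cut at \<open>k\<close>
    lies at most \<open>k\<close> letters in.\<close>
  obtain i where i: "prefix_word ((seq_shift ^^ i) u) (k + L) = prefix_word x (k + L)"
      "prefix_word ((seq_shift ^^ ?len u i) u) (?len x (k + L)) = prefix_word (subst_seq \<tau> x) (?len x (k + L))"
    using occ[OF x] by blast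
  obtain j where j: "prefix_word ((seq_shift ^^ ?len u j) u) (?len y L) = prefix_word (subst_seq \<tau> y) (?len y L)"
    using occ[OF y] by blast
  have len_ge: "n \<le> ?len z n" for z n using length_subst_word[OF subst, of "prefix_word z n"] by simp
  \<comment> \<open>The window of length \<open>L\<close> at the cut \<open>?len u j\<close> recurs
    at \<open>?len u i + k\<close>, so recognizability makes the latter a cut too.\<close>
  have "prefix_word ((seq_shift ^^ ?len u j) u) L = prefix_word (subst_seq \<tau> y) L"
    using prefix_word_mono[OF j len_ge] .
  also have "\<dots> = prefix_word ((seq_shift ^^ k) ((seq_shift ^^ ?len u i) u)) L"
    unfolding eq[symmetric]
    by (rule prefix_word_shift_eq[OF prefix_word_mono[OF i(2) len_ge], symmetric])
  also have "\<dots> = prefix_word ((seq_shift ^^ (?len u i + k)) u) L"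
    by (simp add: shift_pow add.assoc)
  finally have "map u [?len u j..<?len u j + L] = map u [?len u i + k..<?len u i + k + L]"
    by (simp only: map_upt_prefix_word)
  then have "?len u i + k \<in> cut_points \<tau> u" using L cut_iff by blast
  then obtain p' where p': "?len u i + k = ?len u p'" using cut_iff by blast
  have "i \<le> p'"
  proof (rule ccontr)
    assume "\<not> i \<le> p'"
    then obtain d where d: "i = p' + Suc d" using less_imp_Suc_add[of p' i] by auto
    then have "prefix_word u i = prefix_word u p' @ prefix_word ((seq_shift ^^ p') u) (Suc d)"
      by (simp only: prefix_word_add)
    then have "?len u i = ?len u p' + ?len ((seq_shift ^^ p') u) (Suc d)" by simp
    then show False using p' len_ge[of "Suc d" "(seq_shift ^^ p') u"] by linarith
  qed
  then obtain p where p: "p' = i + p" using le_Suc_ex by blast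
  have k: "k = ?len ((seq_shift ^^ i) u) p" using p' p by (simp add: prefix_word_add)
  then have "p \<le> k" using len_ge by metis
  then have "prefix_word ((seq_shift ^^ i) u) p = prefix_word x p"
    using prefix_word_mono[OF i(1), of p] by simp
  then show ?thesis using k by metis
qed

text \<open>The end of the first block of one point is a cut for the other, so by symmetry the first
  blocks have equal length and are the same word. Injectivity on letters identifies the first
  letters, and the argument continues with the shifted points.\<close>

lemma subst_seq_inj:
  assumes "x \<in> X" "y \<in> X" "subst_seq \<tau> x = subst_seq \<tau> y"
  shows "x = y"
proof -
  have first: "length (\<tau> (x 0)) \<le> length (\<tau> (y 0))"
    if x: "x \<in> X" and y: "y \<in> X" and e: "subst_seq \<tau> x = subst_seq \<tau> y" for x y
  proof -
    let ?k = "length (subst_word \<tau> (prefix_word y 1))"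
    have "(seq_shift ^^ ?k) (subst_seq \<tau> x) = subst_seq \<tau> ((seq_shift ^^ 1) y)"
      using shift_subst_seq[OF subst, of y 1] e by simp
    then obtain p where p: "?k = length (subst_word \<tau> (prefix_word x p))"
      using image_shift_cut[OF x subst_space_shift[OF y, of 1]] by blast
    have "?k \<noteq> 0" using subst by (simp add: prefix_word_def substitution_def)
    then obtain p' where "p = Suc p'" using p by (cases p) auto
    then show ?thesis using p by (simp add: prefix_word_Suc)
  qed
  have "x n = y n" if "x \<in> X" "y \<in> X" "subst_seq \<tau> x = subst_seq \<tau> y" for n x y
    using that
  proof (induction n arbitrary: x y)
    case 0
    have l: "length (\<tau> (x 0)) = length (\<tau> (y 0))"
      using first[of x y] first[of y x] 0 by simp
    have "prefix_word (subst_seq \<tau> z) (length (\<tau> (z 0))) = \<tau> (z 0)" for z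
      using prefix_word_subst_seq[OF subst, of z 1] by (simp add: prefix_word_def)
    then have "\<tau> (x 0) = \<tau> (y 0)" using 0(3) l by metis
    then show ?case using inj by (simp add: inj_eq)
  next
    case (Suc n)
    have l: "length (\<tau> (x 0)) = length (\<tau> (y 0))"
      using first[of x y] first[of y x] Suc.prems by simp
    have s: "(seq_shift ^^ length (\<tau> (z 0))) (subst_seq \<tau> z) = subst_seq \<tau> (seq_shift z)" for z
      using shift_subst_seq[OF subst, of z 1] by (simp add: prefix_word_def)
    have "subst_seq \<tau> (seq_shift x) = subst_seq \<tau> (seq_shift y)"
      using s[of x] s[of y] l Suc.prems(3) by simp
    then have "seq_shift x n = seq_shift y n"
      using Suc.IH[of "seq_shift x" "seq_shift y"] subst_space_shift[of _ \<tau> 1] Suc.prems by simp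
    then show ?case by (simp add: seq_shift_def)
  qed
  then show ?thesis using assms by blast
qed

lemma image_shift:
  assumes "x \<in> X" "y \<in> X" "(seq_shift ^^ k) (subst_seq \<tau> x) = subst_seq \<tau> y"
  shows "\<exists>p. k = length (subst_word \<tau> (prefix_word x p)) \<and> (seq_shift ^^ p) x = y"
proof -
  obtain p where p: "k = length (subst_word \<tau> (prefix_word x p))" using image_shift_cut[OF assms] ..
  then have "subst_seq \<tau> ((seq_shift ^^ p) x) = subst_seq \<tau> y"
    using shift_subst_seq[OF subst, of x p] assms(3) by simp
  then show ?thesis using subst_seq_inj[OF subst_space_shift[OF assms(1)] assms(2)] p by blast
qed

section \<open>Consequences of minimality and of growth\<close>

lemma orbit_closure:
  assumes "x \<in> X" "closedin (subst_topology \<tau>) C" "\<And>n. (seq_shift ^^ n) x \<in> C"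
  shows "X \<subseteq> C"
proof -
  have "subst_topology \<tau> closure_of {(seq_shift ^^ n) x | n. True} \<subseteq> C"
    by (rule closure_of_minimal) (use assms in auto)
  then show ?thesis using minimal assms(1) by (simp add: minimal_system_def)
qed

lemma orbit_hits:
  assumes "x \<in> X" "y \<in> X"
  shows "\<exists>i. prefix_word ((seq_shift ^^ i) x) n = prefix_word y n"
proof (rule ccontr)
  assume *: "\<not> ?thesis"
  have "closedin (subst_topology \<tau>) {z \<in> X. prefix_word z n \<noteq> prefix_word y n}"
    unfolding subst_topology_def by (rule closedin_prefix_determined[of _ n]) simp
  then have "X \<subseteq> {z \<in> X. prefix_word z n \<noteq> prefix_word y n}"
    by (rule orbit_closure[OF assms(1)]) (use * subst_space_shift[OF assms(1)] in auto)
  then show False using assms(2) by blast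
qed

text \<open>Without a bound, compactness would produce a point whose whole orbit avoids the
  cylinder.\<close>

lemma orbit_hits_bounded:
  assumes "y \<in> X"
  shows "\<exists>K. \<forall>x\<in>X. \<exists>i\<le>K. prefix_word ((seq_shift ^^ i) x) n = prefix_word y n"
proof (rule ccontr)
  let ?C = "\<lambda>K. {x \<in> X. \<forall>i\<le>K. prefix_word ((seq_shift ^^ i) x) n \<noteq> prefix_word y n}"
  assume *: "\<not> ?thesis"
  have "(\<Inter>K. ?C K) \<noteq> {}"
  proof (rule compact_space_imp_nest[OF compact_subst])
    fix K
    show "?C K \<noteq> {}" using * by blast
    show "closedin (subst_topology \<tau>) (?C K)"
      unfolding subst_topology_def
    proof (rule closedin_prefix_determined[of _ "K + n"])
      fix x z assume xz: "prefix_word x (K + n) = prefix_word z (K + n)"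
        and x: "\<forall>i\<le>K. prefix_word ((seq_shift ^^ i) x) n \<noteq> prefix_word y n"
      show "\<forall>i\<le>K. prefix_word ((seq_shift ^^ i) z) n \<noteq> prefix_word y n"
      proof (intro allI impI)
        fix i assume "i \<le> K"
        then have "prefix_word ((seq_shift ^^ i) x) n = prefix_word ((seq_shift ^^ i) z) n"
          by (intro prefix_word_shift_eq prefix_word_mono[OF xz]) simp
        then show "prefix_word ((seq_shift ^^ i) z) n \<noteq> prefix_word y n" using x \<open>i \<le> K\<close> by metis
      qed
    qed
  qed (auto simp: decseq_def)
  then obtain x where x: "\<And>K. x \<in> ?C K" by blast
  obtain i where "prefix_word ((seq_shift ^^ i) x) n = prefix_word y n"
    using orbit_hits[OF _ assms] x by blast
  then show False using x[of i] by blast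
qed

text \<open>The image of the shift is closed and contains the dense orbit of
  \<open>seq_shift x\<close>.\<close>

lemma shift_surj:
  assumes "x \<in> X" shows "\<exists>a. conc [a] x \<in> X"
proof -
  have "closedin (subst_topology \<tau>) (seq_shift ` X)"
    using continuous_imp_closed_map[OF continuous_shift compact_subst Hausdorff_subst]
    by (metis closed_map_def closedin_topspace topspace_subst)
  moreover have "(seq_shift ^^ n) (seq_shift x) \<in> seq_shift ` X" for n
    using subst_space_shift[OF assms, of n] by (metis funpow_swap1 image_eqI)
  ultimately have "X \<subseteq> seq_shift ` X"
    using orbit_closure subst_space_shift[OF assms, of 1] by simp
  then obtain z where "z \<in> X" "x = seq_shift z" using assms by blast
  then show ?thesis using conc_singleton_shift[of z] by metis
qed

text \<open>By left properness every \<open>\<tau> a\<close> begins with \<open>u 0\<close>, so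
  every letter grows at least as \<open>u 0\<close> does, one step later.\<close>

lemma power_length_unbounded: "\<exists>n. M \<le> length ((subst_word \<tau> ^^ n) [a])"
proof -
  have "eventually (\<lambda>n. M \<le> length (subst_power \<tau> n (u 0))) sequentially"
    using generating by (auto simp: generating_fixed_point_def filterlim_at_top)
  then obtain n where n: "M \<le> length ((subst_word \<tau> ^^ n) [u 0])"
    by (auto simp: eventually_sequentially subst_power_def)
  have ne: "\<tau> b \<noteq> []" for b using subst by (simp add: substitution_def)
  have "u 0 = hd (\<tau> (u 0))"
    using nth_subst_seq[OF subst, of 0 u 1] fixed ne[of "u 0"] by (simp add: prefix_word_def hd_conv_nth)
  then have "hd (\<tau> a) = u 0" using left_proper unfolding left_proper_def by metis
  then have "\<tau> a = [u 0] @ tl (\<tau> a)" using ne[of a] by (cases "\<tau> a") auto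
  then have "sublist [u 0] (\<tau> a)" by (metis sublist_append_rightI)
  then have "sublist ((subst_word \<tau> ^^ n) [u 0]) ((subst_word \<tau> ^^ n) (subst_word \<tau> [a]))"
    by (intro sublist_subst_word_pow) simp
  then have "length ((subst_word \<tau> ^^ n) [u 0]) \<le> length ((subst_word \<tau> ^^ Suc n) [a])"
    unfolding funpow_Suc_right comp_apply by (rule sublist_length_le)
  then have "M \<le> length ((subst_word \<tau> ^^ Suc n) [a])" using n by linarith
  then show ?thesis ..
qed

lemma continuous_conc_subst_seq:
  assumes "A \<subseteq> X"
  shows "continuous_map (subtopology (subst_topology \<tau>) A) seq_topology (\<lambda>x. conc w (subst_seq \<tau> x))"
proof -
  have "continuous_map (subtopology seq_topology A) seq_topology (\<lambda>x. conc w (subst_seq \<tau> x))"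
  proof (rule continuous_prefix_determined)
    fix i
    have "conc w (subst_seq \<tau> x) i = conc w (subst_seq \<tau> y) i"
      if xy: "prefix_word x (Suc i) = prefix_word y (Suc i)" for x y
    proof -
      have "prefix_word x (Suc j) = prefix_word y (Suc j)" if "j \<le> i" for j
        by (rule prefix_word_mono[OF xy]) (use that in simp)
      then have "subst_seq \<tau> x j = subst_seq \<tau> y j" if "j \<le> i" for j
        using that by (simp only: subst_seq_def)
      then show ?thesis by (simp only: conc_def diff_le_self)
    qed
    then show "\<exists>n. \<forall>x\<in>A. \<forall>y\<in>A. prefix_word x n = prefix_word y n \<longrightarrow>
        conc w (subst_seq \<tau> x) i = conc w (subst_seq \<tau> y) i" by blast
  qed
  moreover have "subtopology (subst_topology \<tau>) A = subtopology seq_topology A"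
    using assms by (simp add: subst_topology_def subtopology_subtopology Int_absorb1)
  ultimately show ?thesis by simp
qed

section \<open>The branch point and the word \<open>w\<close>\<close>

lemma not_suffix:
  assumes "conc [a] y \<in> X" "conc [b] y \<in> X" "a \<noteq> b"
  shows "\<not> suffix (\<tau> a) (\<tau> b)"
proof
  assume "suffix (\<tau> a) (\<tau> b)"
  then obtain s where s: "\<tau> b = s @ \<tau> a" by (auto simp: suffix_def)
  have "subst_seq \<tau> (conc [b] y) = conc s (subst_seq \<tau> (conc [a] y))"
    by (simp add: subst_seq_conc[OF subst] s conc_append)
  then have "(seq_shift ^^ length s) (subst_seq \<tau> (conc [b] y)) = subst_seq \<tau> (conc [a] y)"
    by (simp add: shift_conc)
  then obtain p where p: "length s = length (subst_word \<tau> (prefix_word (conc [b] y) p))"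
      "(seq_shift ^^ p) (conc [b] y) = conc [a] y"
    using image_shift[OF assms(2,1)] by blast
  show False
  \<comment> \<open>The tail starts fewer than \<open>length (\<tau> b)\<close> letters in, because
    \<open>\<tau> a\<close> is nonempty. The only cut available is the one at 0, and then the two
    left extensions of \<open>y\<close> coincide.\<close>
  proof (cases p)
    case 0
    then have "conc [b] y 0 = conc [a] y 0" using p(2) by simp
    then show False using assms(3) by (simp add: conc_def)
  next
    case (Suc p')
    then have "length (\<tau> b) \<le> length s" using p(1) by (simp add: prefix_word_Suc conc_def)
    moreover have "\<tau> a \<noteq> []" using subst by (simp add: substitution_def)
    ultimately show False using s by simp
  qed
qed

lemma suffix_decomp:
  assumes "\<not> suffix v v'" "\<not> suffix v' v"
  shows "\<exists>w c d s t. c \<noteq> d \<and> v = s @ c # w \<and> v' = t @ d # w"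
proof -
  have "rev v \<parallel> rev v'" using assms by (simp add: suffix_to_prefix parallel_def)
  then obtain w c s d t where "c \<noteq> d" "rev v = w @ c # s" "rev v' = w @ d # t"
    using parallel_decomp by blast
  then have "c \<noteq> d" "v = rev s @ c # rev w" "v' = rev t @ d # rev w"
    by (auto simp: rev_eq_append_conv rev_swap)
  then show ?thesis by blast
qed

text \<open>Both image sequences have the tail \<open>conc w (subst_seq \<tau> y)\<close>, preceded
  by the different letters \<open>c\<close> and \<open>d\<close>.\<close>

lemma branch_image:
  assumes "conc [a] y \<in> X" "conc [b] y \<in> X" "\<tau> a = s @ c # w" "\<tau> b = t @ d # w" "c \<noteq> d"
  shows "branch_point \<tau> (conc w (subst_seq \<tau> y))"
proof -
  have mem: "conc [c] (conc w (subst_seq \<tau> y)) \<in> X" if "conc [a] y \<in> X" "\<tau> a = s @ c # w" for a c s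
  proof -
    have "subst_seq \<tau> (conc [a] y) = conc s (conc [c] (conc w (subst_seq \<tau> y)))"
      by (simp add: subst_seq_conc[OF subst] that(2) flip: conc_append)
    then show ?thesis using subst_space_subst_seq[OF subst that(1)] subst_space_conc_tail by metis
  qed
  have 1: "conc [c] (conc w (subst_seq \<tau> y)) \<in> X" using mem assms by blast
  have 2: "conc [d] (conc w (subst_seq \<tau> y)) \<in> X" using mem assms by blast
  have "conc [c] (conc w (subst_seq \<tau> y)) 0 \<noteq> conc [d] (conc w (subst_seq \<tau> y)) 0"
    using assms(5) by (simp add: conc_def)
  then show ?thesis
    unfolding branch_point_def using 1 2 subst_space_conc_tail[OF 1] by (metis seq_shift_conc)
qed

text \<open>Minimal length makes \<open>w\<close> a suffix of every image: the common suffix of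
  \<open>\<tau> a\<close> and \<open>\<tau> e\<close> is at least as long as \<open>w\<close>, and
  two suffixes of \<open>\<tau> a\<close> are nested.\<close>

lemma branch_point_fixed:
  assumes "branch_point \<tau> y0" and unique: "\<And>x. branch_point \<tau> x \<Longrightarrow> x = y0"
  shows "\<exists>w. conc w (subst_seq \<tau> y0) = y0 \<and> (\<forall>a. conc [a] y0 \<in> X \<longrightarrow> suffix w (\<tau> a))"
proof -
  let ?P = "{a. conc [a] y0 \<in> X}"
  let ?D = "\<lambda>n. \<exists>a\<in>?P. \<exists>b\<in>?P. \<exists>w c d s t. a \<noteq> b \<and> c \<noteq> d \<and> \<tau> a = s @ c # w \<and> \<tau> b = t @ d # w \<and> length w = n"
  have decomp: "\<exists>w c d s t. c \<noteq> d \<and> \<tau> a = s @ c # w \<and> \<tau> b = t @ d # w"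
    if "a \<in> ?P" "b \<in> ?P" "a \<noteq> b" for a b
    using that not_suffix[of a y0 b] not_suffix[of b y0 a] by (intro suffix_decomp) auto
  obtain y z where yz: "y \<in> X" "z \<in> X" "y \<noteq> z" "seq_shift y = y0" "seq_shift z = y0"
    using assms(1) by (auto simp: branch_point_def)
  have y: "y = conc [y 0] y0" "z = conc [z 0] y0" using conc_singleton_shift yz(4,5) by metis+
  then have "y 0 \<in> ?P" "z 0 \<in> ?P" "y 0 \<noteq> z 0" using yz by auto
  then have "\<exists>n. ?D n" using decomp by blast
  define n where "n = (LEAST n. ?D n)"
  have "?D n" unfolding n_def using \<open>\<exists>n. ?D n\<close> by (rule LeastI_ex)
  then obtain a b w c d s t where ab: "a \<in> ?P" "b \<in> ?P" "a \<noteq> b" "c \<noteq> d"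
    "\<tau> a = s @ c # w" "\<tau> b = t @ d # w" "length w = n" by blast
  have "branch_point \<tau> (conc w (subst_seq \<tau> y0))"
    using branch_image[of a y0 b] ab by blast
  then have 1: "conc w (subst_seq \<tau> y0) = y0" by (rule unique)
  have 2: "suffix w (\<tau> e)" if e: "e \<in> ?P" for e
  proof (cases "e = a")
    case True
    then show ?thesis using ab(5) by (auto simp: suffix_def)
  next
    case False
    then obtain w' c' d' s' t' where w': "c' \<noteq> d'" "\<tau> a = s' @ c' # w'" "\<tau> e = t' @ d' # w'"
      using decomp[OF ab(1) e] by metis
    then have "a \<noteq> e \<and> c' \<noteq> d' \<and> \<tau> a = s' @ c' # w' \<and> \<tau> e = t' @ d' # w' \<and> length w' = length w'"
      using False by simp
    then have "?D (length w')" using ab(1) e by blast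
    then have "length w \<le> length w'" unfolding ab(7) n_def by (rule Least_le)
    moreover have "suffix w (\<tau> a)" using ab(5) by (auto simp: suffix_def)
    moreover have "suffix w' (\<tau> a)" using w'(2) by (auto simp: suffix_def)
    ultimately have "suffix w w'" by (metis suffix_length_suffix)
    then show ?thesis using w'(3) by (auto simp: suffix_def)
  qed
  show ?thesis using 1 2 by blast
qed

text \<open>Each of the finitely many letters that do not extend \<open>y0\<close> to the left is
  already refuted by a finite prefix.\<close>

lemma left_extensions_determined:
  "\<exists>n>0. \<forall>y\<in>X. prefix_word y n = prefix_word y0 n \<longrightarrow> (\<forall>a. conc [a] y \<in> X \<longrightarrow> conc [a] y0 \<in> X)"
proof -
  have "\<forall>a\<in>{a. conc [a] y0 \<notin> X}. \<exists>n. prefix_word (conc [a] y0) n \<notin> language \<tau>"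
    by (auto simp: subst_space_iff)
  then obtain l where l: "\<And>a. conc [a] y0 \<notin> X \<Longrightarrow> prefix_word (conc [a] y0) (l a) \<notin> language \<tau>"
    by (metis mem_Collect_eq)
  \<comment> \<open>The successor secures \<open>n > 0\<close>; later the cylinder word must contain
    a letter whose images grow.\<close>
  define n where "n = Suc (Max (range l))"
  have ln: "l a \<le> Suc n" for a
  proof -
    have "l a \<le> Max (range l)" by (rule Max_ge) auto
    then show ?thesis unfolding n_def by linarith
  qed
  have "conc [a] y0 \<in> X" if "y \<in> X" "prefix_word y n = prefix_word y0 n" "conc [a] y \<in> X" for y a
  proof (rule ccontr)
    assume "conc [a] y0 \<notin> X"
    then have "prefix_word (conc [a] y0) (l a) \<notin> language \<tau>" by (rule l)
    moreover have "prefix_word (conc [a] y) (Suc n) = prefix_word (conc [a] y0) (Suc n)"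
      using prefix_word_conc[of "[a]" y n] prefix_word_conc[of "[a]" y0 n] that(2) by simp
    then have "prefix_word (conc [a] y) (l a) = prefix_word (conc [a] y0) (l a)"
      using ln by (rule prefix_word_mono)
    ultimately show False using that(3) unfolding subst_space_iff by metis
  qed
  then show ?thesis by (intro exI[of _ n]) (simp add: n_def)
qed

end

section \<open>The base \<open>Y\<close>, its return words and the map \<open>T\<close>\<close>

locale branch_base = subst_system +
  fixes y0 :: "nat \<Rightarrow> 'a" and w :: "'a list" and N :: nat
  assumes branch: "branch_point \<tau> y0" and branch_unique: "\<And>x. branch_point \<tau> x \<Longrightarrow> x = y0"
    and w_fixed: "conc w (subst_seq \<tau> y0) = y0"
    and w_suffix: "\<And>a. conc [a] y0 \<in> X \<Longrightarrow> suffix w (\<tau> a)"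
    and N_pos: "0 < N"
    and N_extensions: "\<And>y a. \<lbrakk>y \<in> X; prefix_word y N = prefix_word y0 N; conc [a] y \<in> X\<rbrakk> \<Longrightarrow> conc [a] y0 \<in> X"
begin

definition Y where "Y = {y \<in> X. prefix_word y N = prefix_word y0 N}"

definition T where "T y = conc w (subst_seq \<tau> y)"

definition q where "q y = (LEAST n. 0 < n \<and> (seq_shift ^^ n) y \<in> Y)"

definition S where "S y = (seq_shift ^^ q y) y"

definition ret where "ret y = prefix_word y (q y)"

text \<open>This is the return time of \<open>T y\<close> to the \<open>T\<close>-image of
  \<open>Y\<close>: the copies of \<open>w\<close> in front of both points cancel.\<close>

definition height where "height y = length (subst_word \<tau> (ret y))"

lemma y0_mem: "y0 \<in> Y"
  using branch by (simp add: Y_def branch_point_def)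

lemma Y_sub: "y \<in> Y \<Longrightarrow> y \<in> X"
  by (simp add: Y_def)

lemma T_y0: "T y0 = y0"
  using w_fixed by (simp add: T_def)

lemma suffix_last:
  assumes "y \<in> Y" "conc [a] y \<in> X" shows "suffix w (\<tau> a)"
  using assms N_extensions[of y a] w_suffix by (simp add: Y_def)

lemma prefix_word_T:
  "prefix_word (T y) (length w + length (subst_word \<tau> (prefix_word y n))) = w @ subst_word \<tau> (prefix_word y n)"
  unfolding T_def prefix_word_conc prefix_word_subst_seq[OF subst] ..

lemma T_agree:
  assumes "prefix_word y n = prefix_word z n"
  shows "prefix_word (T y) (length w + length (subst_word \<tau> (prefix_word y n))) =
         prefix_word (T z) (length w + length (subst_word \<tau> (prefix_word y n)))"
  using prefix_word_T[of y n] prefix_word_T[of z n] assms by simp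

text \<open>For a left extension of \<open>y\<close> by a letter \<open>a\<close>, the word
  \<open>w\<close> is a suffix of \<open>\<tau> a\<close>, so \<open>T y\<close> is a tail of the
  image of a point of \<open>X\<close>. Its first \<open>N\<close> letters depend only on the common
  prefix of \<open>Y\<close>, so they are those of \<open>T y0\<close>, which is
  \<open>y0\<close>.\<close>

lemma T_mem:
  assumes "y \<in> Y" shows "T y \<in> Y"
proof -
  obtain a where a: "conc [a] y \<in> X" using shift_surj[OF Y_sub[OF assms]] ..
  then obtain s where "\<tau> a = s @ w" using suffix_last[OF assms] by (auto simp: suffix_def)
  then have "subst_seq \<tau> (conc [a] y) = conc s (T y)"
    by (simp add: subst_seq_conc[OF subst] T_def conc_append)
  then have X: "T y \<in> X" using subst_space_subst_seq[OF subst a] subst_space_conc_tail by metis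
  have "N \<le> length w + length (subst_word \<tau> (prefix_word y N))"
    using length_subst_word[OF subst, of "prefix_word y N"] by simp
  moreover have "prefix_word y N = prefix_word y0 N" using assms by (simp add: Y_def)
  ultimately have "prefix_word (T y) N = prefix_word (T y0) N"
    using prefix_word_mono[OF T_agree] by blast
  then show ?thesis using X T_y0 by (simp add: Y_def)
qed

lemma visits_agree:
  assumes "y \<in> X" "z \<in> X" "prefix_word y (n + N) = prefix_word z (n + N)" "i \<le> n"
  shows "(seq_shift ^^ i) y \<in> Y \<longleftrightarrow> (seq_shift ^^ i) z \<in> Y"
proof -
  have "prefix_word ((seq_shift ^^ i) y) N = prefix_word ((seq_shift ^^ i) z) N"
    by (intro prefix_word_shift_eq prefix_word_mono[OF assms(3)]) (use assms(4) in simp)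
  then show ?thesis using subst_space_shift[OF assms(1)] subst_space_shift[OF assms(2)] by (simp add: Y_def)
qed

lemma return_ex:
  "\<exists>K. \<forall>y\<in>X. \<exists>n. 0 < n \<and> n \<le> K \<and> (seq_shift ^^ n) y \<in> Y"
proof -
  obtain K where K: "\<And>x. x \<in> X \<Longrightarrow> \<exists>i\<le>K. prefix_word ((seq_shift ^^ i) x) N = prefix_word y0 N"
    using orbit_hits_bounded[OF Y_sub[OF y0_mem]] by blast
  have "\<exists>n. 0 < n \<and> n \<le> Suc K \<and> (seq_shift ^^ n) y \<in> Y" if "y \<in> X" for y
  proof -
    have "seq_shift y \<in> X" using subst_space_shift[OF that, of 1] by simp
    then obtain i where i: "i \<le> K" "prefix_word ((seq_shift ^^ i) (seq_shift y)) N = prefix_word y0 N"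
      using K by blast
    then have "(seq_shift ^^ Suc i) y \<in> Y"
      using subst_space_shift[OF that, of "Suc i"] unfolding funpow_Suc_right comp_apply by (simp add: Y_def)
    then show ?thesis using i(1) by blast
  qed
  then show ?thesis by blast
qed

lemma q:
  assumes "y \<in> X" shows "0 < q y" "S y \<in> Y"
proof -
  have "\<exists>n. 0 < n \<and> (seq_shift ^^ n) y \<in> Y" using return_ex assms by blast
  then have "0 < q y \<and> (seq_shift ^^ q y) y \<in> Y" unfolding q_def by (rule LeastI_ex)
  then show "0 < q y" "S y \<in> Y" by (auto simp: S_def)
qed

lemma q_le: "\<lbrakk>0 < n; (seq_shift ^^ n) y \<in> Y\<rbrakk> \<Longrightarrow> q y \<le> n"
  unfolding q_def by (rule Least_le) simp

lemma q_bound: "\<exists>K. \<forall>y\<in>X. q y \<le> K"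
  using return_ex q_le by (meson order.trans)

lemma return_agree:
  assumes "y \<in> X" "z \<in> X" "prefix_word y (n + N) = prefix_word z (n + N)" "q y \<le> n"
  shows "q z = q y" "ret z = ret y"
proof -
  have "(seq_shift ^^ q y) z \<in> Y"
    using visits_agree[OF assms(1-4)] q(2)[OF assms(1)] by (simp add: S_def)
  then have 1: "q z \<le> q y" using q_le q(1)[OF assms(1)] by blast
  then have "(seq_shift ^^ q z) y \<in> Y"
    using visits_agree[OF assms(1-3), of "q z"] q(2)[OF assms(2)] assms(4) by (simp add: S_def)
  then have "q y \<le> q z" using q_le q(1)[OF assms(2)] by blast
  then show "q z = q y" using 1 by simp
  moreover have "prefix_word y (q y) = prefix_word z (q y)"
    using prefix_word_mono[OF assms(3), of "q y"] assms(4) by simp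
  ultimately show "ret z = ret y" by (simp add: ret_def)
qed

lemma S_pow_mem: "y \<in> Y \<Longrightarrow> (S ^^ n) y \<in> Y"
  by (induction n) (auto intro: q(2) Y_sub)

text \<open>Converts \<open>j\<close> steps of \<open>S\<close> into elapsed shift time.\<close>

primrec visit where
  "visit y 0 = 0"
| "visit y (Suc j) = visit y j + q ((S ^^ j) y)"

lemma S_pow: "(S ^^ j) y = (seq_shift ^^ visit y j) y"
proof (induction j)
  case (Suc j)
  have "(S ^^ Suc j) y = (seq_shift ^^ q ((S ^^ j) y)) ((S ^^ j) y)" by (simp add: S_def)
  also have "\<dots> = (seq_shift ^^ (q ((S ^^ j) y) + visit y j)) y" unfolding funpow_add comp_apply using Suc by simp
  finally show ?case by (simp add: add.commute)
qed simp

lemma visit_strict_mono: "y \<in> Y \<Longrightarrow> i < j \<Longrightarrow> visit y i < visit y j"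
proof (induction j)
  case (Suc j)
  have "visit y j < visit y (Suc j)" using q(1)[OF Y_sub[OF S_pow_mem[OF Suc.prems(1)]]] by simp
  then show ?case using Suc by (cases "i = j") auto
qed simp

lemma visit_ge: "y \<in> Y \<Longrightarrow> j \<le> visit y j"
proof (induction j)
  case (Suc j)
  then show ?case using visit_strict_mono[of y j "Suc j"] by linarith
qed simp

text \<open>Return times are least, so no step of \<open>S\<close> can jump over the time
  \<open>n\<close>; if \<open>n\<close> were missed, all visit times would stay below it.\<close>

lemma visit_ex:
  assumes "y \<in> Y" "(seq_shift ^^ n) y \<in> Y" shows "\<exists>j. visit y j = n"
proof (rule ccontr)
  assume *: "\<nexists>j. visit y j = n"
  have "visit y j < n" for j
  proof (induction j)
    case 0 then show ?case using * by (metis gr0I visit.simps(1))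
  next
    case (Suc j)
    let ?z = "(S ^^ j) y"
    have "(seq_shift ^^ (n - visit y j)) ?z = (seq_shift ^^ (n - visit y j + visit y j)) y"
      unfolding S_pow funpow_add comp_apply ..
    then have "(seq_shift ^^ (n - visit y j)) ?z \<in> Y" using Suc assms(2) by simp
    then have "q ?z \<le> n - visit y j" using q_le Suc by simp
    then have "visit y (Suc j) \<le> n" using Suc by simp
    then show ?case using * by (metis le_neq_implies_less)
  qed
  then show False using visit_ge[OF assms(1), of n] by (metis not_less)
qed

lemma visit_agree:
  assumes "y \<in> Y" "z \<in> Y" "prefix_word y (n + N) = prefix_word z (n + N)" "visit y j \<le> n"
  shows "visit z j = visit y j \<and> (\<forall>i<j. ret ((S ^^ i) z) = ret ((S ^^ i) y))"
  using assms(4)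
proof (induction j)
  case (Suc j)
  let ?v = "visit y j" and ?y = "(S ^^ j) y" and ?z = "(S ^^ j) z"
  have IH: "visit z j = ?v" "\<forall>i<j. ret ((S ^^ i) z) = ret ((S ^^ i) y)" using Suc by auto
  have "n + N = ?v + ((n - ?v) + N)" using Suc.prems by simp
  then have "prefix_word y (?v + ((n - ?v) + N)) = prefix_word z (?v + ((n - ?v) + N))"
    using assms(3) by metis
  then have "prefix_word ?y ((n - ?v) + N) = prefix_word ?z ((n - ?v) + N)"
    unfolding S_pow IH(1) by (rule prefix_word_shift_eq)
  moreover have "?y \<in> X" "?z \<in> X" using S_pow_mem Y_sub assms(1,2) by auto
  moreover have "q ?y \<le> n - ?v" using Suc.prems by simp
  ultimately have "q ?z = q ?y" "ret ?z = ret ?y" using return_agree by blast+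
  then show ?case using IH by (auto simp: less_Suc_eq)
qed simp

lemma T_decomp:
  assumes "y \<in> Y"
  shows "T y = conc (w @ subst_word \<tau> (ret y)) (subst_seq \<tau> (S y))"
  unfolding T_def conc_append ret_def S_def using subst_seq_decomp[OF subst] by metis

text \<open>The letter before \<open>S y\<close> is the last one of \<open>ret y\<close>, and its
  image ends in \<open>w\<close> because \<open>S y\<close> lies in \<open>Y\<close>. Hence
  \<open>w\<close> followed by the image of \<open>ret y\<close> equals some \<open>v\<close>
  followed by \<open>w\<close>, with \<open>length v = height y\<close>; dropping \<open>v\<close>
  from \<open>T y\<close> leaves \<open>T (S y)\<close>.\<close>

lemma T_S:
  assumes "y \<in> Y" shows "T (S y) = (seq_shift ^^ height y) (T y)"
proof -
  obtain l where l: "q y = Suc l" using q(1)[OF Y_sub[OF assms]] by (cases "q y") auto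
  let ?z = "(seq_shift ^^ l) y"
  have z: "?z \<in> X" using subst_space_shift Y_sub assms by blast
  have "seq_shift ?z = S y" by (simp add: S_def l)
  then have "conc [?z 0] (S y) = ?z" using conc_singleton_shift by metis
  then have "suffix w (\<tau> (?z 0))" using suffix_last[OF q(2)[OF Y_sub[OF assms]]] z by metis
  then obtain s where s: "\<tau> (?z 0) = s @ w" by (auto simp: suffix_def)
  have "ret y = prefix_word y l @ [?z 0]"
    using prefix_word_add[of y l 1] by (simp add: ret_def l prefix_word_Suc)
  then have e: "w @ subst_word \<tau> (ret y) = (w @ subst_word \<tau> (prefix_word y l) @ s) @ w"
    using s by simp
  then have "length (w @ subst_word \<tau> (prefix_word y l) @ s) = height y"
    unfolding height_def by (metis add.commute add_right_cancel length_append)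
  moreover have "T y = conc (w @ subst_word \<tau> (prefix_word y l) @ s) (T (S y))"
    unfolding T_decomp[OF assms] e by (simp only: T_def conc_append)
  ultimately show ?thesis by (metis shift_conc)
qed

lemma height_pos:
  assumes "y \<in> Y" shows "0 < height y"
proof -
  have "q y \<le> height y" using length_subst_word[OF subst, of "ret y"] by (simp add: height_def ret_def)
  then show ?thesis using q(1)[OF Y_sub[OF assms]] by linarith
qed

text \<open>Counts the steps of \<open>S\<close> from \<open>T y\<close> to \<open>T (S y)\<close>,
  where \<open>height y\<close> counts the shifts.\<close>

definition m where "m y = (LEAST j. visit (T y) j = height y)"

lemma visit_m:
  assumes "y \<in> Y" shows "visit (T y) (m y) = height y"
proof -
  have "(seq_shift ^^ height y) (T y) \<in> Y" using T_S[OF assms] T_mem q(2) Y_sub assms by metis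
  then have "\<exists>j. visit (T y) j = height y" using visit_ex T_mem assms by blast
  then show ?thesis unfolding m_def by (rule LeastI_ex)
qed

lemma m_pos:
  assumes "y \<in> Y" shows "0 < m y"
  using visit_m[OF assms] height_pos[OF assms] by (metis gr0I less_irrefl visit.simps(1))

lemma T_S_m: "y \<in> Y \<Longrightarrow> T (S y) = (S ^^ m y) (T y)"
  unfolding S_pow visit_m by (rule T_S)

text \<open>After the common return word both points continue with the \<open>N\<close> letters that
  define \<open>Y\<close>. The images of these letters keep at least \<open>N\<close> positions
  beyond \<open>height y\<close>, enough to decide all visits to \<open>Y\<close> up to that
  time.\<close>

lemma T_agree_label:
  assumes "y \<in> Y" "z \<in> Y" "ret y = ret z"
  shows "prefix_word (T y) (height y + N) = prefix_word (T z) (height y + N)"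
proof -
  have qyz: "q y = q z" using assms(3) by (metis length_prefix_word ret_def)
  have "S y \<in> Y" "S z \<in> Y" using q(2) Y_sub assms by auto
  then have s: "prefix_word (S y) N = prefix_word y0 N" "prefix_word (S z) N = prefix_word y0 N"
    by (auto simp: Y_def)
  have p: "prefix_word y (q y + N) = ret y @ prefix_word y0 N"
    "prefix_word z (q y + N) = ret y @ prefix_word y0 N"
    using s assms(3) qyz by (auto simp: prefix_word_add ret_def S_def)
  then have "prefix_word y (q y + N) = prefix_word z (q y + N)" by simp
  moreover have "height y + N \<le> length w + length (subst_word \<tau> (prefix_word y (q y + N)))"
    using length_subst_word[OF subst, of "prefix_word y0 N"] by (simp add: p(1) height_def)
  ultimately show ?thesis using prefix_word_mono[OF T_agree] by blast
qed

lemma height_label: "ret y = ret z \<Longrightarrow> height y = height z"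
  by (simp add: height_def)

lemma label_agree:
  assumes "y \<in> Y" "z \<in> Y" "ret y = ret z"
  shows "m y = m z" "k < m y \<Longrightarrow> ret ((S ^^ k) (T y)) = ret ((S ^^ k) (T z))"
proof -
  have *: "visit (T z) (m y) = visit (T y) (m y) \<and> (\<forall>i<m y. ret ((S ^^ i) (T z)) = ret ((S ^^ i) (T y)))"
    by (rule visit_agree[OF T_mem[OF assms(1)] T_mem[OF assms(2)] T_agree_label[OF assms]])
       (simp add: visit_m[OF assms(1)])
  then have "visit (T z) (m y) = visit (T z) (m z)"
    using visit_m[OF assms(1)] visit_m[OF assms(2)] height_label[OF assms(3)] by simp
  then show "m y = m z" using visit_strict_mono[OF T_mem[OF assms(2)]] by (metis less_irrefl nat_neq_iff)
  show "k < m y \<Longrightarrow> ret ((S ^^ k) (T y)) = ret ((S ^^ k) (T z))" using * by simp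
qed

section \<open>Towers over \<open>Y\<close> and over its image under \<open>T\<close>\<close>

lemma T_inj: "inj_on T Y"
proof (rule inj_onI)
  fix y z assume "y \<in> Y" "z \<in> Y" "T y = T z"
  then show "y = z" using conc_inj[of w] subst_seq_inj[of y z] Y_sub by (simp add: T_def)
qed

lemma finite_ret: "finite (ret ` X)"
proof -
  obtain K where K: "\<And>y. y \<in> X \<Longrightarrow> q y \<le> K" using q_bound by blast
  have "ret ` X \<subseteq> {v. length v \<le> K}" using K by (auto simp: ret_def)
  moreover have "finite {v :: 'a list. length v \<le> K}"
    using finite_lists_length_le[OF finite[of "UNIV :: 'a set"], of K] by simp
  ultimately show ?thesis by (rule finite_subset)
qed

lemma height_bound: "\<exists>M. \<forall>y\<in>Y. height y < M"
proof -
  have "height ` Y \<subseteq> (\<lambda>v. length (subst_word \<tau> v)) ` ret ` X" using Y_sub by (auto simp: height_def)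
  then have "finite (height ` Y)" using finite_ret finite_subset by blast
  then show ?thesis by (metis finite_nat_set_iff_bounded imageI)
qed

lemma closed_Y: "closedin (subst_topology \<tau>) Y"
  unfolding subst_topology_def Y_def by (rule closedin_prefix_determined[of _ N]) simp

lemma continuous_T: "continuous_map (subtopology (subst_topology \<tau>) Y) (subst_topology \<tau>) T"
proof -
  have "continuous_map (subtopology (subst_topology \<tau>) Y) seq_topology T"
    using continuous_conc_subst_seq[of Y w] Y_sub unfolding T_def by blast
  then show ?thesis
    using T_mem Y_sub by (auto simp: subst_topology_def continuous_map_in_subtopology)
qed

lemma closed_T_Y: "closedin (subst_topology \<tau>) (T ` Y)"
  using closedin_continuous_image[OF compact_subst Hausdorff_subst closed_Y continuous_T closed_Y] by simp

text \<open>
  A tower whose base is closed and contains \<open>y0\<close> covers the forward orbit of \<open>y0\<close>, which is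
  dense, so it covers everything.
\<close>
lemma tower_covers:
  assumes closed: "closedin (subst_topology \<tau>) (b ` Y)" and b_y0: "b y0 = y0"
    and R: "\<And>y. y \<in> Y \<Longrightarrow> 0 < R y" "\<And>y. y \<in> Y \<Longrightarrow> (seq_shift ^^ R y) (b y) \<in> b ` Y"
    and bound: "\<And>y. y \<in> Y \<Longrightarrow> R y < M" and x: "x \<in> X"
  shows "\<exists>k. \<exists>y\<in>Y. x = (seq_shift ^^ k) (b y)"
proof -
  have orbit: "\<exists>y\<in>Y. \<exists>k<R y. (seq_shift ^^ n) y0 = (seq_shift ^^ k) (b y)" for n
  proof (induction n)
    case 0
    then show ?case using y0_mem R(1)[OF y0_mem] b_y0 by (intro bexI[of _ y0] exI[of _ 0]) auto
  next
    case (Suc n)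
    then obtain y k where y: "y \<in> Y" "k < R y" "(seq_shift ^^ n) y0 = (seq_shift ^^ k) (b y)" by blast
    then have e: "(seq_shift ^^ Suc n) y0 = (seq_shift ^^ Suc k) (b y)" by simp
    show ?case
    proof (cases "Suc k < R y")
      case True then show ?thesis using y e by blast
    next
      case False
      then have "Suc k = R y" using y by simp
      then obtain y' where "y' \<in> Y" "(seq_shift ^^ Suc n) y0 = (seq_shift ^^ 0) (b y')"
        using R(2)[OF y(1)] e by auto
      then show ?thesis using R(1) by blast
    qed
  qed
  \<comment> \<open>Bounded return times make this a finite union of closed sets.\<close>
  let ?C = "\<Union>k\<in>{..<M}. (seq_shift ^^ k) ` b ` Y"
  have "closedin (subst_topology \<tau>) ?C"
    by (intro closedin_UN closedin_funpow_image compact_subst Hausdorff_subst continuous_shift closed) simp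
  moreover have "(seq_shift ^^ n) y0 \<in> ?C" for n
    using orbit[of n] bound by (blast intro: order.strict_trans)
  ultimately have "X \<subseteq> ?C" using orbit_closure[OF Y_sub[OF y0_mem]] by blast
  then show ?thesis using x by blast
qed

lemma shift_branch: "\<lbrakk>x \<in> X; z \<in> X; seq_shift x = seq_shift z; x \<noteq> z\<rbrakk> \<Longrightarrow> seq_shift x = y0"
  using subst_space_shift[of x \<tau> 1] by (intro branch_unique) (auto simp: branch_point_def)

lemma tower_X:
  assumes "x \<in> X"
  shows "\<exists>!p. fst p \<in> Y \<and> snd p < q (fst p) \<and> x = (seq_shift ^^ snd p) (fst p)"
proof -
  obtain K where K: "\<And>y. y \<in> X \<Longrightarrow> q y \<le> K" using q_bound by blast
  have "\<exists>k. \<exists>y\<in>Y. x = (seq_shift ^^ k) ((\<lambda>y. y) y)"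
  proof (rule tower_covers[where R = q and M = "Suc K"])
    show "closedin (subst_topology \<tau>) ((\<lambda>y. y) ` Y)" using closed_Y by simp
    show "(seq_shift ^^ q y) y \<in> (\<lambda>y. y) ` Y" if "y \<in> Y" for y
      using q(2)[OF Y_sub[OF that]] by (simp add: S_def)
    show "q y < Suc K" "0 < q y" if "y \<in> Y" for y using K q(1) Y_sub[OF that] by (auto simp: less_Suc_eq_le)
  qed (use assms in auto)
  then show ?thesis
  proof (rule tower_unique[where Z = X and b = "\<lambda>y. y" and z\<^sub>0 = y0, rotated -1])
    show "seq_shift z \<in> X" if "z \<in> X" for z using subst_space_shift[OF that, of 1] by simp
    show "(seq_shift ^^ i) y \<notin> (\<lambda>y. y) ` Y" if "y \<in> Y" "0 < i" "i < q y" for y i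
      using q_le[of i y] that by auto
    show "(seq_shift ^^ q y) y \<in> (\<lambda>y. y) ` Y" "0 < q y" if "y \<in> Y" for y
      using q[OF Y_sub[OF that]] by (auto simp: S_def)
    show "seq_shift z = y0" if "z \<in> X" "z' \<in> X" "seq_shift z = seq_shift z'" "z \<noteq> z'" for z z'
      using shift_branch[OF that] .
  qed (use Y_sub y0_mem in auto)
qed

text \<open>If the points one shift before \<open>S y\<close> and \<open>S z\<close> differ, the
  shift merges them, necessarily at \<open>y0\<close>. If they are equal, uniqueness of addresses
  gives \<open>y = z\<close>.\<close>

lemma S_branch:
  assumes "y \<in> Y" "z \<in> Y" "S y = S z" "y \<noteq> z" shows "S y = y0"
proof (rule ccontr)
  assume *: "S y \<noteq> y0"
  obtain k where k: "q y = Suc k" using q(1)[OF Y_sub[OF assms(1)]] by (cases "q y") auto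
  obtain l where l: "q z = Suc l" using q(1)[OF Y_sub[OF assms(2)]] by (cases "q z") auto
  let ?a = "(seq_shift ^^ k) y" and ?b = "(seq_shift ^^ l) z"
  have X: "?a \<in> X" "?b \<in> X" using subst_space_shift Y_sub assms by auto
  have "seq_shift ?a = S y" "seq_shift ?b = S z" by (auto simp: S_def k l)
  then have ab: "?a = ?b" using shift_branch[OF X] assms(3) * by metis
  have "p = p'" if "fst p \<in> Y \<and> snd p < q (fst p) \<and> ?a = (seq_shift ^^ snd p) (fst p)"
      "fst p' \<in> Y \<and> snd p' < q (fst p') \<and> ?a = (seq_shift ^^ snd p') (fst p')" for p p'
    using tower_X[OF X(1)] that by blast
  from this[of "(y, k)" "(z, l)"] have "(y, k) = (z, l)" using assms(1,2) k l ab by simp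
  then show False using assms(4) by simp
qed

lemma tower_Y:
  assumes "x \<in> Y"
  shows "\<exists>!p. fst p \<in> Y \<and> snd p < m (fst p) \<and> x = (S ^^ snd p) (T (fst p))"
proof -
  obtain M where M: "\<And>y. y \<in> Y \<Longrightarrow> height y < M" using height_bound by blast
  have "\<exists>k. \<exists>y\<in>Y. x = (seq_shift ^^ k) (T y)"
  proof (rule tower_covers[where R = height and M = M])
    show "(seq_shift ^^ height y) (T y) \<in> T ` Y" if "y \<in> Y" for y
      using T_S[OF that] q(2)[OF Y_sub[OF that]] by (metis imageI)
  qed (use M closed_T_Y T_y0 height_pos assms Y_sub in auto)
  then obtain k y where y: "y \<in> Y" "x = (seq_shift ^^ k) (T y)" by blast
  \<comment> \<open>As \<open>x\<close> lies in \<open>Y\<close>, the time \<open>k\<close> is a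
    visit, so the shifts add up to steps of \<open>S\<close>.\<close>
  then obtain j where "visit (T y) j = k" using visit_ex[OF T_mem] assms by blast
  then have "x = (S ^^ j) (T y)" using y by (simp add: S_pow)
  then have "\<exists>k. \<exists>y\<in>Y. x = (S ^^ k) (T y)" using y(1) by blast
  then show ?thesis
  proof (rule tower_unique[where Z = Y and b = T and z\<^sub>0 = y0, rotated -1])
    show "S z \<in> Y" if "z \<in> Y" for z using q(2) Y_sub that by blast
    show "(S ^^ m y) (T y) \<in> T ` Y" if "y \<in> Y" for y
      using T_S_m[OF that] q(2)[OF Y_sub[OF that]] by (metis imageI)
    show "y0 \<in> T ` Y" using T_y0 y0_mem by (metis imageI)
    show "(S ^^ i) (T y) \<notin> T ` Y" if y: "y \<in> Y" and i: "0 < i" "i < m y" for y i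
    proof
      \<comment> \<open>Dropping \<open>w\<close> on both sides, the image of \<open>z\<close> is a
        tail of the image of \<open>y\<close>. Recognizability makes \<open>z\<close> itself a later
        point \<open>(seq_shift ^^ p) y\<close>; as \<open>z\<close> lies in \<open>Y\<close>,
        \<open>p\<close> is at least \<open>q y\<close>, so the elapsed time is at least
        \<open>height y\<close>.\<close>
      assume "(S ^^ i) (T y) \<in> T ` Y"
      then obtain z where z: "z \<in> Y" "(S ^^ i) (T y) = T z" by blast
      define k where "k = visit (T y) i"
      have k: "0 < k" "k < height y"
        using visit_strict_mono[OF T_mem[OF y], of 0 i] visit_strict_mono[OF T_mem[OF y], of i "m y"]
          visit_m[OF y] i by (auto simp: k_def)
      have "(seq_shift ^^ k) (T y) = T z" using z(2) by (simp add: S_pow k_def)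
      then have "(seq_shift ^^ length w) ((seq_shift ^^ k) (T y)) = subst_seq \<tau> z"
        by (simp add: T_def shift_conc)
      then have "(seq_shift ^^ k) ((seq_shift ^^ length w) (T y)) = subst_seq \<tau> z"
        by (simp add: shift_pow add.left_commute)
      then have "(seq_shift ^^ k) (subst_seq \<tau> y) = subst_seq \<tau> z" by (simp add: T_def shift_conc)
      then obtain p where p: "k = length (subst_word \<tau> (prefix_word y p))" "(seq_shift ^^ p) y = z"
        using image_shift[OF Y_sub[OF y] Y_sub[OF z(1)]] by blast
      have "0 < p" using p(1) k(1) by (cases p) auto
      then have "q y \<le> p" using q_le[of p y] p(2) z(1) by simp
      then obtain d where "p = q y + d" using le_Suc_ex by blast
      then have "height y \<le> k" using p(1) by (simp add: prefix_word_add height_def ret_def)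
      then show False using k(2) by simp
    qed
    show "S z = y0" if "z \<in> Y" "z' \<in> Y" "S z = S z'" "z \<noteq> z'" for z z' using S_branch[OF that] .
  qed (fact T_mem T_inj m_pos)+
qed

lemma T_pow_mem: "y \<in> Y \<Longrightarrow> (T ^^ n) y \<in> Y"
  by (induction n) (auto intro: T_mem)

lemma T_pow_prefix:
  assumes "y \<in> Y"
  shows "prefix_word ((T ^^ n) y) (length (((\<lambda>v. w @ subst_word \<tau> v) ^^ n) (prefix_word y0 N))) =
    ((\<lambda>v. w @ subst_word \<tau> v) ^^ n) (prefix_word y0 N)"
proof (induction n)
  case 0
  then show ?case using assms by (simp add: Y_def)
next
  case (Suc n)
  let ?v = "((\<lambda>v. w @ subst_word \<tau> v) ^^ n) (prefix_word y0 N)"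
  show ?case using prefix_word_T[of "(T ^^ n) y" "length ?v"] unfolding Suc by simp
qed

text \<open>The points \<open>(T ^^ n) y\<close> share a prefix at least as long as the
  \<open>n\<close>-th image of the letter \<open>y0 0\<close>. Once it has \<open>q y0 + N\<close>
  letters, it decides the first return and hence the return word.\<close>

lemma label_contract: "\<exists>n. \<forall>y\<in>Y. ret ((T ^^ n) y) = ret y0"
proof -
  let ?W = "\<lambda>v. w @ subst_word \<tau> v" and ?v = "prefix_word y0 N"
  obtain n where n: "q y0 + N \<le> length ((subst_word \<tau> ^^ n) [y0 0])"
    using power_length_unbounded by blast
  have "?v = [y0 0] @ prefix_word (seq_shift y0) (N - 1)"
    using N_pos prefix_word_Suc[of y0 "N - 1"] by simp
  then have "sublist [y0 0] ?v" by (metis sublist_append_rightI)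
  then have "sublist ((subst_word \<tau> ^^ n) [y0 0]) ((subst_word \<tau> ^^ n) ?v)"
    by (rule sublist_subst_word_pow)
  moreover have "sublist ((subst_word \<tau> ^^ n) ?v) ((?W ^^ n) ?v)" for n
  proof (induction n)
    case (Suc n)
    then have "sublist ((subst_word \<tau> ^^ Suc n) ?v) (subst_word \<tau> ((?W ^^ n) ?v))"
      by (simp add: sublist_subst_word)
    then show ?case by (simp add: sublist_order.order.trans[OF _ sublist_append_leftI])
  qed simp
  ultimately have len: "q y0 + N \<le> length ((?W ^^ n) ?v)"
    using n sublist_length_le le_trans by metis
  have y0: "(T ^^ n) y0 = y0" by (induction n) (auto simp: T_y0)
  have "ret ((T ^^ n) y) = ret y0" if y: "y \<in> Y" for y
  proof -
    have "prefix_word ((T ^^ n) y0) (length ((?W ^^ n) ?v)) = prefix_word ((T ^^ n) y) (length ((?W ^^ n) ?v))"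
      using T_pow_prefix[OF y, of n] T_pow_prefix[OF y0_mem, of n] by simp
    then have "prefix_word y0 (q y0 + N) = prefix_word ((T ^^ n) y) (q y0 + N)"
      unfolding y0 using len by (rule prefix_word_mono)
    then show ?thesis
      using return_agree(2)[OF Y_sub[OF y0_mem] Y_sub[OF T_pow_mem[OF y]]] by blast
  qed
  then show ?thesis by blast
qed

lemma recurrent:
  assumes "y \<in> Y" shows "\<exists>i. (seq_shift ^^ i) y0 \<in> Y \<and> ret ((seq_shift ^^ i) y0) = ret y"
proof -
  obtain i where i: "prefix_word ((seq_shift ^^ i) y0) (q y + N) = prefix_word y (q y + N)"
    using orbit_hits[OF Y_sub[OF y0_mem] Y_sub[OF assms]] by blast
  have X: "(seq_shift ^^ i) y0 \<in> X" using subst_space_shift Y_sub y0_mem by blast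
  have "ret ((seq_shift ^^ i) y0) = ret y"
    using return_agree(2)[OF Y_sub[OF assms] X i[symmetric]] by simp
  moreover have "(seq_shift ^^ i) y0 \<in> Y"
    using visits_agree[OF X Y_sub[OF assms] i, of 0] assms by simp
  ultimately show ?thesis by blast
qed

lemma closed_ret: "closedin (subst_topology \<tau>) {y \<in> Y. ret y = v}"
proof -
  obtain K where K: "\<And>y. y \<in> X \<Longrightarrow> q y \<le> K" using q_bound by blast
  have "closedin (subst_topology \<tau>) {y \<in> X. y \<in> Y \<and> ret y = v}"
    unfolding subst_topology_def
  proof (rule closedin_prefix_determined[of _ "K + N"])
    fix x z assume xz: "x \<in> X" "z \<in> X" "prefix_word x (K + N) = prefix_word z (K + N)" "x \<in> Y \<and> ret x = v"
    then show "z \<in> Y \<and> ret z = v"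
      using return_agree(2)[OF xz(1-3)] visits_agree[OF xz(1-3), of 0] K[OF xz(1)] by simp
  qed
  moreover have "{y \<in> X. y \<in> Y \<and> ret y = v} = {y \<in> Y. ret y = v}" using Y_sub by blast
  ultimately show ?thesis by (simp only:)
qed

text \<open>Return words pass through \<open>to_nat\<close> because the vertices are natural
  numbers.\<close>

lemma self_induced:
  "self_induced_system (subst_topology \<tau>) seq_shift Y T (\<lambda>y. to_nat (ret y)) q m S y0"
proof
  fix x x'
  assume x: "x \<in> topspace (subst_topology \<tau>)" "x' \<in> topspace (subst_topology \<tau>)"
    and edges: "\<And>i. \<exists>y\<in>Y. \<exists>y'\<in>Y. \<exists>k<q y. to_nat (ret y) = to_nat (ret y') \<and>
      (seq_shift ^^ i) x = (seq_shift ^^ k) y \<and> (seq_shift ^^ i) x' = (seq_shift ^^ k) y'"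
  show "x = x'"
  proof
    fix i
    obtain y y' k where y: "k < q y" "to_nat (ret y) = to_nat (ret y')"
      "(seq_shift ^^ i) x = (seq_shift ^^ k) y" "(seq_shift ^^ i) x' = (seq_shift ^^ k) y'"
      using edges[of i] by blast
    have r: "ret y = ret y'" using y(2) by simp
    then have "q y = q y'" by (metis length_prefix_word ret_def)
    \<comment> \<open>Both sequences show at \<open>i\<close> the letter at position
      \<open>k\<close> of the common return word.\<close>
    then have "y k = y' k" using r y(1) unfolding ret_def by (metis nth_prefix_word)
    then show "x i = x' i" using fun_cong[OF y(3), of 0] fun_cong[OF y(4), of 0] by (simp add: shift_pow)
  qed
next
  show "closedin (subst_topology \<tau>) {y \<in> Y. to_nat (ret y) = a}" for a
  proof (cases "a \<in> range (to_nat :: 'a list \<Rightarrow> nat)")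
    case True
    then obtain v :: "'a list" where "a = to_nat v" by blast
    then show ?thesis using closed_ret[of v] by simp
  next
    case False
    then have "{y \<in> Y. to_nat (ret y) = a} = {}" by auto
    then show ?thesis by (simp only: closedin_empty)
  qed
  have "ret ` Y \<subseteq> ret ` X" using Y_sub by blast
  then have "finite (ret ` Y)" using finite_ret by (rule finite_subset)
  then have "finite (to_nat ` ret ` Y)" by (rule finite_imageI)
  then show "finite ((\<lambda>y. to_nat (ret y)) ` Y)" by (simp only: image_image)
  show "q y = q z" if "to_nat (ret y) = to_nat (ret z)" for y z
  proof -
    have "ret y = ret z" using that by simp
    then show ?thesis by (metis length_prefix_word ret_def)
  qed
  show "m y = m z" if "y \<in> Y" "z \<in> Y" "to_nat (ret y) = to_nat (ret z)" for y z
    using label_agree(1)[OF that(1,2)] that(3) by simp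
  show "\<exists>n. \<forall>y\<in>Y. to_nat (ret ((T ^^ n) y)) = to_nat (ret y0)"
    using label_contract by metis
  show "\<exists>i. (seq_shift ^^ i) y0 \<in> Y \<and> to_nat (ret ((seq_shift ^^ i) y0)) = to_nat (ret y)" if "y \<in> Y" for y
    using recurrent[OF that] by metis
  show "to_nat (ret ((S ^^ k) (T y))) = to_nat (ret ((S ^^ k) (T z)))"
    if "y \<in> Y" "z \<in> Y" "to_nat (ret y) = to_nat (ret z)" "k < m y" for y z k
    using label_agree(2)[OF that(1,2) _ that(4)] that(3) by simp
  show "\<exists>!p. fst p \<in> Y \<and> snd p < q (fst p) \<and> x = (seq_shift ^^ snd p) (fst p)"
    if "x \<in> topspace (subst_topology \<tau>)" for x using tower_X that by simp
  show "\<exists>!p. fst p \<in> Y \<and> snd p < m (fst p) \<and> y = (S ^^ snd p) (T (fst p))" if "y \<in> Y" for y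
    using tower_Y[OF that] .
  show "S y = (seq_shift ^^ q y) y" for y by (rule S_def)
  show "0 < q y" "S y \<in> Y" if "y \<in> Y" for y using q[OF Y_sub[OF that]] .
qed (use compact_subst Hausdorff_subst continuous_shift closed_Y continuous_T T_mem m_pos T_S_m y0_mem T_y0 in blast)+

end

theorem theorem13:
  fixes \<tau> :: "'a::finite \<Rightarrow> 'a list" and u :: "nat \<Rightarrow> 'a"
  assumes "substitution \<tau>"
    and "generating_fixed_point \<tau> u"
    and "left_proper \<tau>"
    and "reasonable \<tau> u"
    and "quasi_invertible \<tau>"
  shows "\<exists>B :: (nat, nat) ordered_bratteli.
           semi_proper B \<and> stationary B \<and>
           topologically_conjugate (path_topology B) (vershik_map B) (subst_topology \<tau>) seq_shift"
proof -
  have reasonable: "minimal_subst \<tau>" "recognizable \<tau> u" "injective_subst (subst_power \<tau> 1)"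
    using assms(4) by (auto simp: reasonable_def)
  have "subst_power \<tau> 1 = \<tau>" by (simp add: subst_power_def subst_word_def fun_eq_iff)
  then interpret subst_system \<tau> u
    using assms(1-3) reasonable by unfold_locales (auto simp: minimal_subst_def injective_subst_def)
  obtain y0 where y0: "branch_point \<tau> y0" "\<And>x. branch_point \<tau> x \<Longrightarrow> x = y0"
    using assms(5) unfolding quasi_invertible_def by blast
  obtain w where w: "conc w (subst_seq \<tau> y0) = y0" "\<And>a. conc [a] y0 \<in> subst_space \<tau> \<Longrightarrow> suffix w (\<tau> a)"
    using branch_point_fixed[OF y0] by blast
  obtain N where N: "N > 0" "\<And>y a. \<lbrakk>y \<in> subst_space \<tau>; prefix_word y N = prefix_word y0 N;
      conc [a] y \<in> subst_space \<tau>\<rbrakk> \<Longrightarrow> conc [a] y0 \<in> subst_space \<tau>"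
    using left_extensions_determined[of y0] by blast
  interpret branch_base \<tau> u y0 w N
    by unfold_locales (fact y0 w N)+
  interpret model: self_induced_system "subst_topology \<tau>" seq_shift Y T "\<lambda>y. to_nat (ret y)" q m S y0
    by (rule self_induced)
  show ?thesis using model.bratteli_vershik_model by blast
qed

end
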